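(* Let $k$ be a non-positive integer and let $d$ be a positive integer with $d\ge -6k+8$. Let $Q_d:=(-\pi,\pi)^d$ and let $\psi\in C^\infty(\overline{Q_d})$ be a complex-valued function all of whose derivatives (including $\psi$ itself) are $2\pi$-periodic in each variable, and which has zero average, $\int_{Q_d}\psi\,dx=0$. Then $$HR(k,d)\int_{Q_d}|\nabla\psi(x)|^2\,\omega(x)^{k-1}\,dx\;\le\;\int_{Q_d}|\Delta\psi(x)|^2\,\omega(x)^{k}\,dx,$$ where $\omega(x):=\sum_{j=1}^d\sin^2(x_j/2)$, $\Delta$ is the usual Laplacian, $$HR(k,d)^{-1}:=\sum_{j=0}^{-k}d^{\,j}\,C_1(k+j,d)\prod_{i=0}^{j-1}C_2(k+i,d)\;+\;d^{-k}\prod_{i=0}^{-k}C_2(k+i,d),$$ $$C_1(k,d):=\frac{16}{(d-2k)^2},\qquad C_2(k,d):=\frac{3d-2k+4}{d(d-2k)} .$$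
   Context: A function $\psi:\overline{Q_d}\to\mathbb{C}$ is $2\pi$-periodic in each variable if $\psi(x_1,\dots,x_{i-1},-\pi,x_{i+1},\dots,x_d)=\psi(x_1,\dots,x_{i-1},\pi,x_{i+1},\dots,x_d)$ for all $1\le i\le d$. Empty products equal $1$. *)

theory Defs
  imports "HOL-Analysis.Analysis"
begin

definition Q :: "(real ^ 'n) set" where
  "Q = box (\<chi> i. - pi) (\<chi> i. pi)"

text \<open>
  Partial derivatives relative to a set \<open>S\<close>: only values of \<open>f\<close> on \<open>S\<close> enter. For \<open>S = closure Q\<close>
  this is the one-sided derivative in direction \<open>i\<close> at points of the two faces orthogonal to
  that direction and, by the lemma below, the ordinary partial derivative on \<open>Q\<close>.
\<close>

definition partial_within ::
    "(real ^ 'n) set \<Rightarrow> 'n \<Rightarrow> (real ^ 'n \<Rightarrow> complex) \<Rightarrow> real ^ 'n \<Rightarrow> complex" where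
  "partial_within S i f x =
     vector_derivative (\<lambda>t. f (x + t *\<^sub>R axis i 1)) (at 0 within {t. x + t *\<^sub>R axis i 1 \<in> S})"

definition partial_differentiable_within ::
    "(real ^ 'n) set \<Rightarrow> 'n \<Rightarrow> (real ^ 'n \<Rightarrow> complex) \<Rightarrow> real ^ 'n \<Rightarrow> bool" where
  "partial_differentiable_within S i f x \<longleftrightarrow>
     (\<lambda>t. f (x + t *\<^sub>R axis i 1)) differentiable (at 0 within {t. x + t *\<^sub>R axis i 1 \<in> S})"

lemma partial_within_interior:
  assumes "x \<in> interior S"
  shows "partial_within S i f x = vector_derivative (\<lambda>t. f (x + t *\<^sub>R axis i 1)) (at 0)"
proof -
  define g where "g = (\<lambda>t. x + t *\<^sub>R axis i (1::real))"
  have "continuous_on UNIV g"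
    unfolding g_def by (intro continuous_intros)
  then have "open (g -` interior S)"
    by (rule open_vimage[OF open_interior])
  moreover have "0 \<in> g -` interior S"
    unfolding g_def using assms by simp
  moreover have "g -` interior S \<subseteq> {t. g t \<in> S}"
    using interior_subset by blast
  ultimately have "0 \<in> interior {t. x + t *\<^sub>R axis i 1 \<in> S}"
    unfolding g_def by (rule interiorI)
  then show ?thesis
    unfolding partial_within_def by (simp only: at_within_interior)
qed

text \<open>\<open>iter_partial S [i\<^sub>1, \<dots>, i\<^sub>m] f\<close> is the derivative of \<open>f\<close> of order \<open>m\<close> in directions
  \<open>i\<^sub>m, \<dots>, i\<^sub>1\<close>, the last entry being applied first; \<open>iter_partial S [] f\<close> is \<open>f\<close> itself.\<close>

definition iter_partial ::
    "(real ^ 'n) set \<Rightarrow> 'n list \<Rightarrow> (real ^ 'n \<Rightarrow> complex) \<Rightarrow> real ^ 'n \<Rightarrow> complex" where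
  "iter_partial S is f = foldr (partial_within S) is f"

text \<open>
  Meant for closed cubes: derivatives of all orders exist up to the boundary and are continuous
  there. For \<open>S = closure Q\<close> this is the same as asking that \<open>f\<close> be continuous on \<open>closure Q\<close> and
  smooth in \<open>Q\<close> with all derivatives extending continuously to \<open>closure Q\<close>; the iterated
  derivatives on \<open>closure Q\<close> are these extensions.
\<close>

definition C_infinity_on :: "(real ^ 'n) set \<Rightarrow> (real ^ 'n \<Rightarrow> complex) \<Rightarrow> bool" where
  "C_infinity_on S f \<longleftrightarrow>
     (\<forall>is. continuous_on S (iter_partial S is f) \<and>
           (\<forall>i. \<forall>x\<in>S. partial_differentiable_within S i (iter_partial S is f) x))"

definition periodic_each_var :: "(real ^ 'n \<Rightarrow> complex) \<Rightarrow> bool" where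
  "periodic_each_var f \<longleftrightarrow>
     (\<forall>x \<in> closure Q. \<forall>i. f (\<chi> j. if j = i then - pi else x $ j) =
                            f (\<chi> j. if j = i then pi else x $ j))"

definition grad :: "(real ^ 'n \<Rightarrow> complex) \<Rightarrow> real ^ 'n \<Rightarrow> complex ^ 'n" where
  "grad f x = (\<chi> i. partial_within (closure Q) i f x)"

definition laplacian :: "(real ^ 'n \<Rightarrow> complex) \<Rightarrow> real ^ 'n \<Rightarrow> complex" where
  "laplacian f x = (\<Sum>i\<in>UNIV. partial_within (closure Q) i (partial_within (closure Q) i f) x)"

definition \<omega> :: "real ^ 'n \<Rightarrow> real" where
  "\<omega> x = (\<Sum>j\<in>UNIV. (sin (x $ j / 2))\<^sup>2)"

definition C1 :: "int \<Rightarrow> nat \<Rightarrow> real" where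
  "C1 k d = 16 / (real d - 2 * of_int k)\<^sup>2"

definition C2 :: "int \<Rightarrow> nat \<Rightarrow> real" where
  "C2 k d = (3 * real d - 2 * of_int k + 4) / (real d * (real d - 2 * of_int k))"

text \<open>Only used for \<open>k \<le> 0\<close>, where \<open>nat (- k)\<close> is \<open>- k\<close>.\<close>

definition HR :: "int \<Rightarrow> nat \<Rightarrow> real" where
  "HR k d = inverse (
     (\<Sum>j=0..nat (- k). real d ^ j * C1 (k + int j) d * (\<Prod>i<j. C2 (k + int i) d))
     + real d ^ nat (- k) * (\<Prod>i=0..nat (- k). C2 (k + int i) d))"

end

theory Submission
  imports Defs
begin

text \<open>
  Write \<open>n = - k\<close> and \<open>V = 1 / (\<omega> + e)\<close>. Integrating the divergence of
  \<open>\<nabla>u (g \<cdot> \<nabla>u) - g |\<nabla>u|\<^sup>2 / 2\<close> for the periodic field \<open>g\<^sub>j = V\<^sup>n\<^sup>+\<^sup>1 sin x\<^sub>j\<close> over the torus and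
  estimating \<open>\<Delta>u (g \<cdot> \<nabla>u)\<close> by Cauchy-Schwarz gives, as \<open>e \<rightarrow> 0\<close>,
  \<open>\<integral>|\<nabla>u|\<^sup>2 \<omega>\<^sup>k\<^sup>-\<^sup>1 \<le> C1 k d \<integral>|\<Delta>u|\<^sup>2 \<omega>\<^sup>k + C2 k d \<integral>|\<nabla>u|\<^sup>2 \<omega>\<^sup>k\<close>; the radial part of the gradient
  enters with the right sign exactly because \<open>d \<ge> 8 - 6 k\<close>. Since \<open>\<omega> \<le> d\<close>, this can be iterated up
  to \<open>k = 0\<close>, where \<open>\<integral>|\<nabla>u|\<^sup>2 \<le> \<integral>|\<Delta>u|\<^sup>2\<close> follows from Wirtinger's inequality applied to each
  \<open>\<partial>\<^sub>i u\<close> in direction \<open>i\<close>. The divergence theorem for \<open>g\<close> alone shows that \<open>\<omega>\<^sup>-\<^sup>m\<close> is integrable for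
  \<open>2 m < d\<close>.
\<close>

section \<open>The closed cube and its coordinate lines\<close>

definition cube :: "(real ^ 'n) set" where
  "cube = closure Q"

lemma mem_cube: "x \<in> (cube :: (real ^ 'n) set) \<longleftrightarrow> (\<forall>i. \<bar>x $ i\<bar> \<le> pi)"
proof -
  have "closure (Q :: (real ^ 'n) set) = cbox (\<chi> i. - pi) (\<chi> i. pi)"
    unfolding Q_def by (rule closure_box) (auto simp: box_ne_empty Basis_vec_def inner_axis)
  then show ?thesis
    by (auto simp: cube_def mem_box_cart abs_le_iff minus_le_iff)
qed

lemma mem_Q: "x \<in> (Q :: (real ^ 'n) set) \<longleftrightarrow> (\<forall>i. \<bar>x $ i\<bar> < pi)"
  by (auto simp: Q_def mem_box_cart abs_less_iff minus_less_iff)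

lemma Q_subset_cube: "Q \<subseteq> cube"
  by (auto simp: cube_def intro: subsetD[OF closure_subset])

lemma open_Q: "open Q"
  unfolding Q_def by (rule open_box)

lemma Q_sets [measurable]: "Q \<in> sets borel"
  by (rule borel_open[OF open_Q])

lemma compact_cube: "compact cube"
  by (simp add: cube_def Q_def bounded_box)

abbreviation along :: "real ^ 'n \<Rightarrow> 'n \<Rightarrow> real \<Rightarrow> real ^ 'n" where
  "along x i t \<equiv> x + t *\<^sub>R axis i 1"

lemma along_nth: "along x i t $ j = (if j = i then x $ j + t else x $ j)"
  by (auto simp: axis_def)

lemma along_add: "along (along x i s) i t = along x i (s + t)"
  by (simp add: algebra_simps)

lemma along_mem_cube: "x \<in> cube \<Longrightarrow> x $ i = 0 \<Longrightarrow> t \<in> {-pi..pi} \<Longrightarrow> along x i t \<in> cube"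
  unfolding mem_cube along_nth by auto

lemma continuous_on_along:
  fixes f :: "real ^ 'n \<Rightarrow> 'a :: topological_space"
  assumes "continuous_on cube f" "x \<in> cube" "x $ i = 0"
  shows "continuous_on {-pi..pi} (\<lambda>t. f (along x i t))"
  by (rule continuous_on_compose2[OF assms(1)]) (use assms in \<open>auto intro!: continuous_intros along_mem_cube\<close>)

lemma set_integrable_Q:
  fixes f :: "real ^ 'n \<Rightarrow> real"
  assumes "continuous_on cube f"
  shows "set_integrable lborel Q f"
proof -
  have "set_integrable lborel cube f"
    unfolding set_integrable_def by (rule borel_integrable_compact[OF compact_cube assms])
  then show ?thesis
    by (rule set_integrable_subset) (auto simp: Q_subset_cube)
qed

subsection \<open>Integration over the cube along coordinate lines\<close>

text \<open>Fubini with the coordinate \<open>i\<close> innermost. A statement about signs serves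
  both uses: applied to a function and its negative it shows that an integral vanishes, applied to a
  difference it compares two integrals.\<close>

lemma integral_slices_nonneg:
  fixes h :: "real ^ 'n \<Rightarrow> real"
  assumes h: "continuous_on cube h"
    and slice: "\<And>x. x \<in> cube \<Longrightarrow> x $ i = 0 \<Longrightarrow> 0 \<le> integral {-pi..pi} (\<lambda>t. h (along x i t))"
  shows "0 \<le> (LINT x:Q|lborel. h x)"
proof -
  define e :: "real ^ 'n" where "e = axis i 1"
  define B where "B = Basis - {e}"
  define F where "F f = (\<Sum>b\<in>Basis. f b *\<^sub>R b)" for f :: "real ^ 'n \<Rightarrow> real"
  define g where "g x = indicat_real Q x * h x" for x
  interpret product_sigma_finite "\<lambda>_ :: real ^ 'n. lborel :: real measure"
    by standard
  have e: "e \<in> Basis" by (auto simp: e_def Basis_vec_def)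
  then have ins: "Basis = insert e B" and B: "finite B" "e \<notin> B"
    by (auto simp: B_def)
  have g: "integrable lborel g"
    using set_integrable_Q[OF h] by (simp add: set_integrable_def g_def[abs_def])
  then have g_meas: "g \<in> borel_measurable borel" by auto
  \<comment> \<open>\<open>lborel\<close> on vectors is the image under \<open>F\<close> of the
    product of one-dimensional measures over \<open>Basis\<close>. Writing \<open>Basis\<close> as
    \<open>insert e B\<close> singles out the direction to be integrated first.\<close>
  have eq: "lborel = distr (\<Pi>\<^sub>M b\<in>insert e B. lborel) borel F"
    using lborel_eq[where 'a="real ^ 'n"] by (simp add: F_def[abs_def] ins)
  have F_meas: "F \<in> measurable (\<Pi>\<^sub>M b\<in>insert e B. lborel) borel"
    unfolding F_def ins by measurable
  have int: "integrable (\<Pi>\<^sub>M b\<in>insert e B. lborel) (\<lambda>f. g (F f))"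
    using g integrable_distr_eq[OF F_meas g_meas] eq by simp
  have "(LINT x:Q|lborel. h x) = integral\<^sup>L lborel g"
    by (simp add: set_lebesgue_integral_def g_def[abs_def])
  also have "\<dots> = integral\<^sup>L (\<Pi>\<^sub>M b\<in>insert e B. lborel) (\<lambda>f. g (F f))"
    by (subst eq) (rule integral_distr[OF F_meas g_meas])
  also have "\<dots> = (\<integral>f. (\<integral>t. g (F (f(e := t))) \<partial>lborel) \<partial>(\<Pi>\<^sub>M b\<in>B. lborel))"
    by (rule product_integral_insert[OF B int])
  also have "\<dots> \<ge> 0"
  proof (rule integral_nonneg_AE, rule AE_I2)
    fix f :: "real ^ 'n \<Rightarrow> real"
    define x where "x = F (f(e := 0))"
    have Fx: "F (f(e := t)) = along x i t" for t
    proof -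
      have "F (f(e := t)) = t *\<^sub>R e + (\<Sum>b\<in>B. f b *\<^sub>R b)" for t
        unfolding F_def ins using B by (auto intro!: sum.cong)
      then show ?thesis by (simp add: x_def e_def add.commute)
    qed
    have xi: "x $ i = 0"
    proof -
      have "x \<bullet> e = 0" using e unfolding x_def F_def
        by (auto intro!: sum.neutral simp: inner_sum_left inner_Basis)
      then show ?thesis by (simp add: e_def inner_axis)
    qed
    show "0 \<le> (\<integral>t. g (F (f(e := t))) \<partial>lborel)"
    \<comment> \<open>\<open>x\<close> is the point of the line with coordinate \<open>i\<close>
      equal to 0. If it lies in \<open>Q\<close>, the line meets \<open>Q\<close> exactly for
      parameters in the open interval from \<open>- pi\<close> to \<open>pi\<close>; otherwise some
      other coordinate is too large and the line misses \<open>Q\<close>.\<close>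
    proof (cases "x \<in> Q")
      case True
      then have xc: "x \<in> cube" using Q_subset_cube by auto
      have "along x i t \<in> Q \<longleftrightarrow> t \<in> {-pi<..<pi}" for t
      proof -
        have "along x i t \<in> Q \<longleftrightarrow> \<bar>x $ i + t\<bar> < pi \<and> (\<forall>j. j \<noteq> i \<longrightarrow> \<bar>x $ j\<bar> < pi)"
          unfolding mem_Q along_nth by auto
        then show ?thesis using True xi by (auto simp: mem_Q)
      qed
      then have "(\<integral>t. g (F (f(e := t))) \<partial>lborel) = (LINT t:{-pi<..<pi}|lborel. h (along x i t))"
        unfolding Fx g_def set_lebesgue_integral_def by (auto intro!: Bochner_Integration.integral_cong simp: indicator_def)
      also have "\<dots> = integral {-pi<..<pi} (\<lambda>t. h (along x i t))"
      proof (rule set_borel_integral_eq_integral)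
        have "set_integrable lborel {-pi..pi} (\<lambda>t. h (along x i t))"
          unfolding set_integrable_def
          by (intro borel_integrable_compact continuous_on_along h xc xi) auto
        then show "set_integrable lborel {-pi<..<pi} (\<lambda>t. h (along x i t))"
          by (rule set_integrable_subset) auto
      qed
      also have "\<dots> = integral {-pi..pi} (\<lambda>t. h (along x i t))"
        by (rule integral_open_interval_real[symmetric])
      finally show ?thesis using slice[OF xc xi] by simp
    next
      case False
      then have "along x i t \<notin> Q" for t
        using xi unfolding mem_Q along_nth not_all
        by (metis (full_types) abs_zero pi_gt_zero)
      then show ?thesis unfolding Fx g_def by simp
    qed
  qed
  finally show ?thesis .
qed

text \<open>The working notion of a C^1 function on the torus in direction \<open>i\<close>, read on
  the closed cube. Each line is parametrised from its point with coordinate 0, derivatives are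
  one-sided at the two ends, and the equal end values are what removes boundary terms. Closure under
  sums and products then provides all integrations by parts.\<close>

definition periodic_partial :: "'n \<Rightarrow> (real ^ 'n \<Rightarrow> real) \<Rightarrow> (real ^ 'n \<Rightarrow> real) \<Rightarrow> bool" where
  "periodic_partial i f f' \<longleftrightarrow> continuous_on cube f \<and> continuous_on cube f' \<and>
     (\<forall>x\<in>cube. x $ i = 0 \<longrightarrow> f (along x i pi) = f (along x i (- pi)) \<and>
       (\<forall>t\<in>{-pi..pi}. ((\<lambda>s. f (along x i s)) has_real_derivative f' (along x i t))
          (at t within {-pi..pi})))"

lemma periodic_partialD:
  assumes "periodic_partial i f f'"
  shows "continuous_on cube f" "continuous_on cube f'"
    and "x \<in> cube \<Longrightarrow> x $ i = 0 \<Longrightarrow> f (along x i pi) = f (along x i (- pi))"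
    and "x \<in> cube \<Longrightarrow> x $ i = 0 \<Longrightarrow> t \<in> {-pi..pi} \<Longrightarrow>
      ((\<lambda>s. f (along x i s)) has_real_derivative f' (along x i t)) (at t within {-pi..pi})"
  using assms by (auto simp: periodic_partial_def)

lemma periodic_partial_add:
  "periodic_partial i f f' \<Longrightarrow> periodic_partial i g g' \<Longrightarrow>
   periodic_partial i (\<lambda>x. f x + g x) (\<lambda>x. f' x + g' x)"
  unfolding periodic_partial_def by (auto intro!: continuous_intros derivative_eq_intros)

lemma periodic_partial_mult:
  "periodic_partial i f f' \<Longrightarrow> periodic_partial i g g' \<Longrightarrow>
   periodic_partial i (\<lambda>x. f x * g x) (\<lambda>x. f' x * g x + f x * g' x)"
  unfolding periodic_partial_def
  by (auto intro!: continuous_intros derivative_eq_intros)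

lemma periodic_partial_const: "periodic_partial i (\<lambda>x. c) (\<lambda>x. 0)"
  unfolding periodic_partial_def by auto

lemma periodic_partial_cmult:
  "periodic_partial i f f' \<Longrightarrow> periodic_partial i (\<lambda>x. c * f x) (\<lambda>x. c * f' x)"
  unfolding periodic_partial_def by (auto intro!: continuous_intros derivative_eq_intros)

lemma periodic_partial_sum:
  assumes "\<And>j. j \<in> A \<Longrightarrow> periodic_partial i (f j) (f' j)"
  shows "periodic_partial i (\<lambda>x. \<Sum>j\<in>A. f j x) (\<lambda>x. \<Sum>j\<in>A. f' j x)"
  using assms
  by (induction A rule: infinite_finite_induct)
     (auto intro: periodic_partial_const periodic_partial_add)

text \<open>The divergence theorem on the torus: on every line the fundamental theorem of calculus
  yields a difference of equal end values.\<close>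

lemma integral_periodic_partial:
  assumes "periodic_partial i f f'"
  shows "(LINT x:Q|lborel. f' x) = 0"
proof -
  note * = periodic_partialD[OF assms]
  have zero: "integral {-pi..pi} (\<lambda>t. f' (along x i t)) = 0" if "x \<in> cube" "x $ i = 0" for x
  proof -
    have "((\<lambda>t. f' (along x i t)) has_integral f (along x i pi) - f (along x i (-pi))) {-pi..pi}"
      using *(4)[OF that]
      by (intro fundamental_theorem_of_calculus) (auto simp: has_real_derivative_iff_has_vector_derivative)
    then show ?thesis using *(3)[OF that] by (simp add: integral_unique)
  qed
  have "0 \<le> (LINT x:Q|lborel. f' x)"
    by (rule integral_slices_nonneg[OF *(2), of i]) (simp add: zero)
  moreover have "0 \<le> (LINT x:Q|lborel. - f' x)"
    by (rule integral_slices_nonneg[of _ i]) (simp_all add: zero *(2) continuous_on_minus)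
  ultimately show ?thesis
    by (simp add: set_lebesgue_integral_def)
qed

subsection \<open>Symmetry of second derivatives\<close>

text \<open>Inside the open cube the one-sided derivatives become two-sided. Sliding the base point
  to \<open>y\<close>, which has coordinate 0 in direction \<open>i\<close>, reduces an arbitrary
  base point to the definition.\<close>

lemma periodic_partial_DERIV:
  assumes f: "periodic_partial i f f'" and x: "along x i s \<in> Q"
  shows "((\<lambda>t. f (along x i t)) has_real_derivative f' (along x i s)) (at s)"
proof -
  define y where "y = along x i (- x $ i)"
  define r where "r = x $ i + s"
  have rx: "\<bar>r\<bar> < pi" "\<And>j. j \<noteq> i \<Longrightarrow> \<bar>x $ j\<bar> < pi"
    using x unfolding mem_Q along_nth r_def by (auto dest: spec[of _ i]) (metis (full_types))
  have y: "y \<in> cube" "y $ i = 0"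
    unfolding y_def mem_cube along_nth using rx(2) by (auto intro: less_imp_le)
  have eq: "along x i t = along y i (x $ i + t)" for t
    unfolding y_def along_add by simp
  have "((\<lambda>t. f (along y i t)) has_real_derivative f' (along y i r)) (at r within {-pi..pi})"
    by (rule periodic_partialD(4)[OF f y]) (use rx in auto)
  moreover have "at r within {-pi..pi} = at r"
    using rx by (intro at_within_interior) (auto simp: interior_atLeastAtMost_real)
  ultimately show ?thesis
    unfolding eq r_def using DERIV_shift[of "\<lambda>t. f (along y i t)" _ s "x $ i"]
    by (simp add: add.commute)
qed

text \<open>Write \<open>f\<close> near \<open>x\<close> as an integral of \<open>fi\<close> in
  direction \<open>i\<close>, differentiate under the integral in direction \<open>j\<close>, and
  then differentiate the resulting integral of \<open>fij\<close> in its upper limit.\<close>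

lemma mixed_partials:
  assumes fi: "periodic_partial i f fi" and fj: "periodic_partial j f fj"
    and fij: "periodic_partial j fi fij" and fji: "periodic_partial i fj fji"
    and x: "x \<in> Q"
  shows "fij x = fji x"
proof -
  obtain r where r: "r > 0" "ball x r \<subseteq> Q"
    using open_Q x by (meson open_contains_ball)
  \<comment> \<open>Two displacements of length at most r / 3 stay inside the ball of radius
    r.\<close>
  define \<delta> where "\<delta> = r / 3"
  define z where "z s t = along (along x i s) j t" for s t
  define I where "I = {-\<delta>..\<delta>}"
  have \<delta>: "\<delta> > 0" using r by (simp add: \<delta>_def)
  have z_comm: "z s t = along (along x j t) i s" for s t
    by (simp add: z_def algebra_simps)
  have zQ: "z s t \<in> Q" if "s \<in> I" "t \<in> I" for s t
  proof -
    have "dist x (z s t) = norm (s *\<^sub>R axis i 1 + t *\<^sub>R (axis j 1 :: real ^ 'a))"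
      by (subst dist_commute) (simp add: z_def dist_norm algebra_simps)
    also have "\<dots> \<le> \<bar>s\<bar> + \<bar>t\<bar>"
      by (rule order_trans[OF norm_triangle_ineq]) simp
    also have "\<dots> < r" using that r(1) by (auto simp: I_def \<delta>_def)
    finally show ?thesis using r(2) by auto
  qed
  have I0: "0 \<in> I" and Im: "-\<delta> \<in> I" using \<delta> by (auto simp: I_def)
  have at0: "at 0 within I = at (0::real)"
    using \<delta> by (intro at_within_interior) (auto simp: I_def interior_atLeastAtMost_real)
  have cont: "continuous_on (I \<times> I) (\<lambda>(t, s). g (z s t))" if "continuous_on cube g" for g :: "real ^ 'a \<Rightarrow> real"
    unfolding case_prod_unfold
    by (rule continuous_on_compose2[OF that])
      (use zQ Q_subset_cube in \<open>auto simp: z_def intro!: continuous_intros\<close>)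
  have cont1: "continuous_on I (\<lambda>s. g (z s t))" if "continuous_on cube g" "t \<in> I" for g :: "real ^ 'a \<Rightarrow> real" and t
    by (rule continuous_on_compose2[OF that(1)])
      (use zQ that Q_subset_cube in \<open>auto simp: z_def intro!: continuous_intros\<close>)
  have ftc: "f (z s t) - f (z (-\<delta>) t) = integral {-\<delta>..s} (\<lambda>\<sigma>. fi (z \<sigma> t))" if "s \<in> I" "t \<in> I" for s t
  proof (rule integral_unique[symmetric], rule fundamental_theorem_of_calculus)
    show "-\<delta> \<le> s" using that by (simp add: I_def)
    fix \<sigma> assume "\<sigma> \<in> {-\<delta>..s}"
    then have "z \<sigma> t \<in> Q" using that by (intro zQ) (auto simp: I_def)
    then show "((\<lambda>\<sigma>. f (z \<sigma> t)) has_vector_derivative fi (z \<sigma> t)) (at \<sigma> within {-\<delta>..s})"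
      using has_field_derivative_at_within[OF periodic_partial_DERIV[OF fi]] unfolding z_comm
      by (simp flip: has_real_derivative_iff_has_vector_derivative)
  qed
  \<comment> \<open>Both sides are the derivative at t = 0 of the same difference of values of
    \<open>f\<close>: the left one directly, the right one by the Leibniz rule applied to
    \<open>ftc\<close>.\<close>
  have key: "fj (z s 0) - fj (z (-\<delta>) 0) = integral {-\<delta>..s} (\<lambda>\<sigma>. fij (z \<sigma> 0))" if s: "s \<in> I" for s
  proof (rule DERIV_unique)
    have dj: "((\<lambda>t. f (z s t)) has_real_derivative fj (z s 0)) (at 0)" if "s \<in> I" for s
      using periodic_partial_DERIV[OF fj, of "along x i s" 0] zQ[OF that I0] by (simp add: z_def)
    show "((\<lambda>t. f (z s t) - f (z (-\<delta>) t)) has_real_derivative fj (z s 0) - fj (z (-\<delta>) 0)) (at 0)"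
      by (intro DERIV_diff dj s Im)
    have "((\<lambda>t. integral (cbox (-\<delta>) s) (\<lambda>\<sigma>. fi (z \<sigma> t))) has_real_derivative
        integral (cbox (-\<delta>) s) (\<lambda>\<sigma>. fij (z \<sigma> 0))) (at 0 within I)"
    proof (rule leibniz_rule_field_derivative)
      have sub: "{-\<delta>..s} \<subseteq> I" using s by (auto simp: I_def)
      show "((\<lambda>t. fi (z \<sigma> t)) has_real_derivative fij (z \<sigma> t)) (at t within I)"
        if "t \<in> I" "\<sigma> \<in> cbox (-\<delta>) s" for t \<sigma>
        using has_field_derivative_at_within[OF periodic_partial_DERIV[OF fij, of "along x i \<sigma>" t]]
          zQ[of \<sigma> t] that sub
        by (auto simp: z_def)
      show "(\<lambda>\<sigma>. fi (z \<sigma> t)) integrable_on cbox (-\<delta>) s" if "t \<in> I" for t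
        using cont1[OF periodic_partialD(2)[OF fi] that] sub
        by (intro integrable_continuous) (auto intro: continuous_on_subset)
      show "continuous_on (I \<times> cbox (-\<delta>) s) (\<lambda>(t, \<sigma>). fij (z \<sigma> t))"
        by (rule continuous_on_subset[OF cont[OF periodic_partialD(2)[OF fij]]]) (use sub in auto)
      show "0 \<in> I" by fact
      show "convex I" by (simp add: I_def)
    qed
    then have "((\<lambda>t. integral {-\<delta>..s} (\<lambda>\<sigma>. fi (z \<sigma> t))) has_real_derivative
        integral {-\<delta>..s} (\<lambda>\<sigma>. fij (z \<sigma> 0))) (at 0 within I)"
      by simp
    then have "((\<lambda>t. f (z s t) - f (z (-\<delta>) t)) has_real_derivative
        integral {-\<delta>..s} (\<lambda>\<sigma>. fij (z \<sigma> 0))) (at 0 within I)"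
      by (rule has_field_derivative_transform_within[OF _ zero_less_one I0]) (use ftc s in auto)
    then show "((\<lambda>t. f (z s t) - f (z (-\<delta>) t)) has_real_derivative
        integral {-\<delta>..s} (\<lambda>\<sigma>. fij (z \<sigma> 0))) (at 0)"
      by (simp only: at0)
  qed
  have "((\<lambda>s. integral {-\<delta>..s} (\<lambda>\<sigma>. fij (z \<sigma> 0))) has_real_derivative fij (z 0 0)) (at 0 within I)"
    unfolding I_def
    by (rule integral_has_real_derivative)
      (use cont1[OF periodic_partialD(2)[OF fij] I0] I0 in \<open>auto simp: I_def\<close>)
  then have "((\<lambda>s. fj (z s 0) - fj (z (-\<delta>) 0)) has_real_derivative fij (z 0 0)) (at 0 within I)"
    by (rule has_field_derivative_transform_within[OF _ zero_less_one I0]) (use key in auto)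
  then have "((\<lambda>s. fj (z s 0) - fj (z (-\<delta>) 0)) has_real_derivative fij (z 0 0)) (at 0)"
    by (simp only: at0)
  moreover have "((\<lambda>s. fj (z s 0) - fj (z (-\<delta>) 0)) has_real_derivative fji (z 0 0)) (at 0)"
  proof -
    have "((\<lambda>s. fj (z s 0)) has_real_derivative fji (z 0 0)) (at 0)"
      using periodic_partial_DERIV[OF fji, of "along x j 0" 0] zQ[OF I0 I0] by (simp add: z_def)
    from DERIV_diff[OF this DERIV_const] show ?thesis by simp
  qed
  ultimately have "fij (z 0 0) = fji (z 0 0)" by (rule DERIV_unique)
  then show ?thesis by (simp add: z_def)
qed

subsection \<open>Wirtinger's inequality\<close>

text \<open>Completing a square: T = tan (l (t - m)) solves the Riccati equation T' = l (1 + T^2),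
  so the integrand on the right equals (f' + l f T)^2 plus the derivative of - l f^2 T. Only the
  boundary values of the latter remain.\<close>

lemma tan_energy_bound:
  fixes f f' :: "real \<Rightarrow> real"
  assumes pq: "p \<le> q"
    and f: "\<And>t. t \<in> {p..q} \<Longrightarrow> (f has_real_derivative f' t) (at t within {p..q})"
    and f': "continuous_on {p..q} f'"
    and m: "\<And>t. t \<in> {p..q} \<Longrightarrow> \<bar>l * (t - m)\<bar> < pi / 2"
  shows "l * (f p)\<^sup>2 * tan (l * (p - m)) - l * (f q)\<^sup>2 * tan (l * (q - m))
    \<le> integral {p..q} (\<lambda>t. (f' t)\<^sup>2 - l\<^sup>2 * (f t)\<^sup>2)"
proof -
  define T where "T t = tan (l * (t - m))" for t
  define D where "D t = - 2 * l * f t * f' t * T t - l\<^sup>2 * (f t)\<^sup>2 * (1 + (T t)\<^sup>2)" for t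
  have cos: "cos (l * (t - m)) \<noteq> 0" if "t \<in> {p..q}" for t
    using m[OF that] by (intro less_imp_neq[symmetric] cos_gt_zero_pi) auto
  have T: "(T has_real_derivative l * (1 + (T t)\<^sup>2)) (at t within {p..q})" if "t \<in> {p..q}" for t
  proof -
    have "(T has_real_derivative l * inverse ((cos (l * (t - m)))\<^sup>2)) (at t within {p..q})"
      unfolding T_def[abs_def] using cos[OF that] by (auto intro!: derivative_eq_intros)
    then show ?thesis using cos[OF that] by (simp add: tan_sec T_def power_inverse)
  qed
  have "((\<lambda>t. - l * (f t)\<^sup>2 * T t) has_real_derivative D t) (at t within {p..q})" if "t \<in> {p..q}" for t
    unfolding D_def using f[OF that] T[OF that]
    by (auto intro!: derivative_eq_intros simp: power2_eq_square algebra_simps)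
  then have "(D has_integral (- l * (f q)\<^sup>2 * T q) - (- l * (f p)\<^sup>2 * T p)) {p..q}"
    by (intro fundamental_theorem_of_calculus pq) (simp add: has_real_derivative_iff_has_vector_derivative)
  then have "l * (f p)\<^sup>2 * T p - l * (f q)\<^sup>2 * T q = integral {p..q} D" "D integrable_on {p..q}"
    by (auto simp: integral_unique)
  moreover have "integral {p..q} D \<le> integral {p..q} (\<lambda>t. (f' t)\<^sup>2 - l\<^sup>2 * (f t)\<^sup>2)"
  proof (rule integral_le)
    have "continuous_on {p..q} f" using f by (intro DERIV_continuous_on)
    with f' show "(\<lambda>t. (f' t)\<^sup>2 - l\<^sup>2 * (f t)\<^sup>2) integrable_on {p..q}"
      by (intro integrable_continuous_real continuous_intros)
    fix t
    have "(f' t)\<^sup>2 - l\<^sup>2 * (f t)\<^sup>2 - D t = (f' t + l * f t * T t)\<^sup>2"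
      by (simp add: D_def power2_eq_square algebra_simps)
    then show "D t \<le> (f' t)\<^sup>2 - l\<^sup>2 * (f t)\<^sup>2"
      by (metis diff_ge_0_iff_ge zero_le_power2)
  qed fact
  ultimately show ?thesis by (simp add: T_def)
qed

text \<open>Choosing \<open>c\<close> with \<open>u c = u (c + pi)\<close> splits the period into two arcs of length \<open>pi\<close> on which
  \<open>u - u c\<close> vanishes at both ends; the tangent weight is regular there as long as \<open>l < 1\<close>.\<close>

lemma wirtinger:
  fixes u u' :: "real \<Rightarrow> real"
  assumes u: "\<And>t. t \<in> {-pi..pi} \<Longrightarrow> (u has_real_derivative u' t) (at t within {-pi..pi})"
    and u': "continuous_on {-pi..pi} u'"
    and per: "u pi = u (- pi)" and mean: "integral {-pi..pi} u = 0"
  shows "integral {-pi..pi} (\<lambda>t. (u t)\<^sup>2) \<le> integral {-pi..pi} (\<lambda>t. (u' t)\<^sup>2)"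
proof -
  have cu: "continuous_on {-pi..pi} u" using u by (intro DERIV_continuous_on)
  have cs: "continuous_on {-pi..0} (\<lambda>c. u (c + pi) - u c)"
    by (intro continuous_intros continuous_on_compose2[OF cu]) auto
  \<comment> \<open>By periodicity the difference u (c + pi) - u c takes opposite values at c = - pi
    and c = 0, so it has a zero in between.\<close>
  have "\<exists>c. -pi \<le> c \<and> c \<le> 0 \<and> u (c + pi) - u c = 0"
  proof (cases "u 0 \<le> u pi")
    case True
    then show ?thesis using per by (intro IVT'[OF _ _ _ cs]) auto
  next
    case False
    then show ?thesis using per by (intro IVT2'[OF _ _ _ cs]) auto
  qed
  then obtain c where c: "-pi \<le> c" "c \<le> 0" "u (c + pi) = u c" by auto
  define v where "v t = u t - u c" for t
  have cv: "continuous_on {-pi..pi} v" unfolding v_def by (intro continuous_intros cu)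
  have v: "(v has_real_derivative u' t) (at t within {p..q})"
    if "t \<in> {p..q}" "{p..q} \<subseteq> {-pi..pi}" for t p q
    unfolding v_def using u[of t] that
    by (auto intro!: derivative_eq_intros elim: has_field_derivative_subset)
  have energy: "l\<^sup>2 * integral {-pi..pi} (\<lambda>t. (v t)\<^sup>2) \<le> integral {-pi..pi} (\<lambda>t. (u' t)\<^sup>2)"
    if l: "0 < l" "l < 1" for l
  proof -
    define h where "h t = (u' t)\<^sup>2 - l\<^sup>2 * (v t)\<^sup>2" for t
    \<comment> \<open>The second arc crosses the seam where \<open>- pi\<close> and
      \<open>pi\<close> are identified, so it is treated as two pieces with tangent centres
      \<open>c - pi / 2\<close> and \<open>c + 3 * pi / 2\<close>. These differ by a full period,
      hence the two boundary terms at the seam are \<open>A\<close> and \<open>- A\<close> and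
      cancel.\<close>
    define A where "A = l * (v pi)\<^sup>2 * tan (l * (- pi / 2 - c))"
    have lt: "\<bar>l * (t - m)\<bar> < pi / 2" if "m - pi / 2 \<le> t" "t \<le> m + pi / 2" for t m
    proof -
      have "\<bar>t - m\<bar> \<le> pi / 2" using that by (intro abs_leI) auto
      then have "\<bar>l * (t - m)\<bar> \<le> l * (pi / 2)" using l by (simp add: abs_mult)
      also have "\<dots> < pi / 2" using l by simp
      finally show ?thesis .
    qed
    have sub: "continuous_on {p..q} u'" if "{p..q} \<subseteq> {-pi..pi}" for p q
      using u' that by (rule continuous_on_subset)
    have hi: "h integrable_on {p..q}" if "{p..q} \<subseteq> {-pi..pi}" for p q
      unfolding h_def using that
      by (intro integrable_continuous_real continuous_intros continuous_on_subset[OF cv] sub)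
    have v0: "v c = 0" "v (c + pi) = 0" "v (- pi) = v pi" using c per by (auto simp: v_def)
    have arc: "l * (v p)\<^sup>2 * tan (l * (p - m)) - l * (v q)\<^sup>2 * tan (l * (q - m)) \<le> integral {p..q} h"
      if "p \<le> q" "{p..q} \<subseteq> {-pi..pi}" "m - pi / 2 \<le> p" "q \<le> m + pi / 2" for p q m
      unfolding h_def using that by (intro tan_energy_bound v sub lt) auto
    have arc_mid: "pi - (c + 3 * pi / 2) = - pi / 2 - c" by simp
    have "A \<le> integral {-pi..c} h"
      using arc[of "-pi" c "c - pi / 2"] c v0 by (simp add: A_def algebra_simps)
    moreover have "0 \<le> integral {c..c + pi} h"
      using arc[of c "c + pi" "c + pi / 2"] c v0 by simp
    moreover have "- A \<le> integral {c + pi..pi} h"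
      using arc[of "c + pi" pi "c + 3 * pi / 2"] c v0 arc_mid by (simp add: A_def)
    moreover have "integral {-pi..pi} h = integral {-pi..c} h + integral {c..c + pi} h + integral {c + pi..pi} h"
      using c hi[of c pi] hi[of "-pi" pi]
        Henstock_Kurzweil_Integration.integral_combine[of "-pi" c pi h]
        Henstock_Kurzweil_Integration.integral_combine[of c "c + pi" pi h]
      by simp
    ultimately have "0 \<le> integral {-pi..pi} h" by linarith
    also have "integral {-pi..pi} h = integral {-pi..pi} (\<lambda>t. (u' t)\<^sup>2) - integral {-pi..pi} (\<lambda>t. l\<^sup>2 * (v t)\<^sup>2)"
      unfolding h_def
      by (intro Henstock_Kurzweil_Integration.integral_diff integrable_continuous_real continuous_intros cv u')
    finally show ?thesis by simp
  qed
  have "integral {-pi..pi} (\<lambda>t. (v t)\<^sup>2) \<le> integral {-pi..pi} (\<lambda>t. (u' t)\<^sup>2)"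
  \<comment> \<open>This is the limit l -> 1, with z = l^2.\<close>
  proof (rule field_le_mult_one_interval)
    fix z :: real assume "0 < z" "z < 1"
    then show "z * integral {-pi..pi} (\<lambda>t. (v t)\<^sup>2) \<le> integral {-pi..pi} (\<lambda>t. (u' t)\<^sup>2)"
      using energy[of "sqrt z"] by simp
  qed
  \<comment> \<open>Since \<open>u\<close> has mean zero, subtracting the constant
    \<open>u c\<close> only adds the integral of its square.\<close>
  moreover have "integral {-pi..pi} (\<lambda>t. (u t)\<^sup>2) \<le> integral {-pi..pi} (\<lambda>t. (v t)\<^sup>2)"
  proof -
    have "integral {-pi..pi} (\<lambda>t. (v t)\<^sup>2) = integral {-pi..pi} (\<lambda>t. (u t)\<^sup>2 - (2 * u c) * u t + (u c)\<^sup>2)"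
      by (intro arg_cong[where f="integral _"]) (auto simp: v_def power2_eq_square algebra_simps)
    also have "\<dots> = integral {-pi..pi} (\<lambda>t. (u t)\<^sup>2 - (2 * u c) * u t) + integral {-pi..pi} (\<lambda>t. (u c)\<^sup>2)"
      by (intro Henstock_Kurzweil_Integration.integral_add integrable_continuous_real continuous_intros cu)
    also have "integral {-pi..pi} (\<lambda>t. (u t)\<^sup>2 - (2 * u c) * u t)
        = integral {-pi..pi} (\<lambda>t. (u t)\<^sup>2) - integral {-pi..pi} (\<lambda>t. (2 * u c) * u t)"
      by (intro Henstock_Kurzweil_Integration.integral_diff integrable_continuous_real continuous_intros cu)
    also have "integral {-pi..pi} (\<lambda>t. (2 * u c) * u t) = 0"
      using mean by simp
    finally show ?thesis by simp
  qed
  ultimately show ?thesis by linarith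
qed

text \<open>On every line in direction \<open>i\<close> the function \<open>f'\<close> has mean
  zero, being the derivative of the periodic function \<open>f\<close>, so the one-dimensional
  inequality applies to it line by line.\<close>

lemma wirtinger_partial:
  assumes f: "periodic_partial i f f'" and f': "periodic_partial i f' f''"
  shows "(LINT x:Q|lborel. (f' x)\<^sup>2) \<le> (LINT x:Q|lborel. (f'' x)\<^sup>2)"
proof -
  note c = periodic_partialD(2)[OF f] periodic_partialD(2)[OF f']
  have "0 \<le> (LINT x:Q|lborel. (f'' x)\<^sup>2 - (f' x)\<^sup>2)"
  proof (rule integral_slices_nonneg[of _ i])
    show "continuous_on cube (\<lambda>x. (f'' x)\<^sup>2 - (f' x)\<^sup>2)" by (intro continuous_intros c)
    fix x :: "real ^ 'a" assume x: "x \<in> cube" "x $ i = 0"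
    have int: "((\<lambda>t. f' (along x i t)) has_integral f (along x i pi) - f (along x i (-pi))) {-pi..pi}"
      using periodic_partialD(4)[OF f x]
      by (intro fundamental_theorem_of_calculus) (auto simp: has_real_derivative_iff_has_vector_derivative)
    have "integral {-pi..pi} (\<lambda>t. (f' (along x i t))\<^sup>2) \<le> integral {-pi..pi} (\<lambda>t. (f'' (along x i t))\<^sup>2)"
      using periodic_partialD(3,4)[OF f' x] int periodic_partialD(3)[OF f x]
      by (intro wirtinger continuous_on_along c x) (auto simp: integral_unique)
    then show "0 \<le> integral {-pi..pi} (\<lambda>t. (f'' (along x i t))\<^sup>2 - (f' (along x i t))\<^sup>2)"
      by (subst Henstock_Kurzweil_Integration.integral_diff)
        (auto intro!: integrable_continuous_real continuous_intros continuous_on_along c x)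
  qed
  then show ?thesis
    by (simp add: set_integral_diff set_integrable_Q continuous_on_power c)
qed

lemma periodic_partial_cong:
  "periodic_partial i f f' \<Longrightarrow> (\<And>x. f' x = g' x) \<Longrightarrow> periodic_partial i f g'"
  by (metis ext)

section \<open>The weight \<omega> on the cube\<close>

lemma \<omega>_nonneg: "0 \<le> \<omega> x"
  by (simp add: \<omega>_def sum_nonneg)

lemma \<omega>_le: "\<omega> (x :: real ^ 'n) \<le> real CARD('n)"
  unfolding \<omega>_def
  by (rule order_trans[OF sum_bounded_above[where K=1]]) (auto simp: abs_square_le_1)

lemma \<omega>_measurable [measurable]: "\<omega> \<in> borel_measurable borel"
  unfolding \<omega>_def[abs_def]
  by (intro borel_measurable_continuous_onI continuous_intros) auto

text \<open>The only singularity of negative powers of \<omega> in \<open>Q\<close> is the origin, a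
  null set.\<close>

lemma \<omega>_eq_0_iff:
  assumes "x \<in> Q"
  shows "\<omega> x = 0 \<longleftrightarrow> x = 0"
proof -
  have "sin (x $ j / 2) = 0 \<longleftrightarrow> x $ j = 0" for j
  proof -
    have "\<bar>x $ j\<bar> < pi" using assms by (simp add: mem_Q)
    then have "\<bar>x $ j / 2\<bar> < pi" using pi_gt_zero by (auto simp: abs_less_iff)
    then show ?thesis
      by (metis abs_less_iff divide_eq_0_iff minus_less_iff sin_eq_0_pi sin_zero zero_neq_numeral)
  qed
  then show ?thesis
    unfolding \<omega>_def by (auto simp: sum_nonneg_eq_0_iff vec_eq_iff)
qed

lemma periodic_partial_sin:
  "periodic_partial i (\<lambda>x. sin (x $ j)) (\<lambda>x. if j = i then cos (x $ i) else 0)"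
  unfolding periodic_partial_def along_nth
  by (cases "j = i") (auto intro!: continuous_intros derivative_eq_intros)

lemma periodic_partial_\<omega>: "periodic_partial i \<omega> (\<lambda>x. sin (x $ i) / 2)"
proof -
  have "periodic_partial i (\<lambda>x. (sin (x $ j / 2))\<^sup>2) (\<lambda>x. if j = i then sin (x $ i) / 2 else 0)" for j
  proof -
    have half: "((\<lambda>s. (sin (s / 2))\<^sup>2) has_real_derivative sin t / 2) (at t within A)" for t A
    proof -
      have "((\<lambda>s. (sin (s / 2))\<^sup>2) has_real_derivative sin (t / 2) * cos (t / 2)) (at t within A)"
        by (auto intro!: derivative_eq_intros)
      moreover have "sin (t / 2) * cos (t / 2) = sin t / 2"
        using sin_double[of "t / 2"] by simp
      ultimately show ?thesis by simp
    qed
    show ?thesis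
      unfolding periodic_partial_def along_nth
      by (cases "j = i") (auto intro!: continuous_intros half)
  qed
  from periodic_partial_sum[of UNIV, OF this, of "\<lambda>j. j"] show ?thesis
    by (simp add: \<omega>_def[abs_def])
qed

subsection \<open>The regularized weight\<close>

text \<open>For e > 0 this is differentiable and periodic on the whole cube, the origin included, so
  integration by parts is available before the limit e -> 0.\<close>

definition reg :: "real \<Rightarrow> real ^ 'n \<Rightarrow> real" where
  "reg e x = inverse (\<omega> x + e)"

lemma reg_bounds:
  assumes "0 < e"
  shows "0 < reg e x" "reg e x * \<omega> x \<le> 1"
  using assms \<omega>_nonneg[of x] by (auto simp: reg_def field_simps)

lemma reg_le:
  assumes "0 < e" "\<omega> x \<noteq> 0"
  shows "reg e x \<le> inverse (\<omega> x)"
  using assms \<omega>_nonneg[of x] by (auto simp: reg_def intro!: le_imp_inverse_le)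

lemma periodic_partial_reg:
  assumes e: "0 < e"
  shows "periodic_partial i (\<lambda>x. reg e x ^ m) (\<lambda>x. - real m / 2 * sin (x $ i) * reg e x ^ Suc m)"
proof -
  note w = periodic_partialD[OF periodic_partial_\<omega>[of i]]
  have pos: "\<omega> x + e \<noteq> 0" for x :: "real ^ 'a" using \<omega>_nonneg[of x] e by linarith
  have c: "continuous_on cube (reg e :: real ^ 'a \<Rightarrow> real)"
    unfolding reg_def[abs_def] using pos by (intro continuous_intros w) auto
  have one: "periodic_partial i (reg e) (\<lambda>x. - sin (x $ i) / 2 * (reg e x)\<^sup>2)"
    unfolding periodic_partial_def
  proof (intro conjI ballI impI)
    show "continuous_on cube (\<lambda>x. - sin (x $ i) / 2 * (reg e x)\<^sup>2)"
      by (intro continuous_intros c) auto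
    fix x :: "real ^ 'a" assume x: "x \<in> cube" "x $ i = 0"
    show "reg e (along x i pi) = reg e (along x i (- pi))"
      by (simp add: reg_def w(3)[OF x])
    fix t assume t: "t \<in> {- pi..pi}"
    show "((\<lambda>s. reg e (along x i s)) has_real_derivative - sin (along x i t $ i) / 2 * (reg e (along x i t))\<^sup>2)
      (at t within {- pi..pi})"
      unfolding reg_def using w(4)[OF x t] pos
      by (auto intro!: derivative_eq_intros simp: power2_eq_square)
  qed (rule c)
  show ?thesis
  proof (induction m)
    case 0
    then show ?case using periodic_partial_const[of i 1] by simp
  next
    case (Suc m)
    have "periodic_partial i (\<lambda>x. reg e x ^ Suc m) (\<lambda>x. - sin (x $ i) / 2 * (reg e x)\<^sup>2 * reg e x ^ m +
        reg e x * (- real m / 2 * sin (x $ i) * reg e x ^ Suc m))"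
      using periodic_partial_mult[OF one Suc] by simp
    then show ?case
      by (rule periodic_partial_cong) (simp add: field_simps power2_eq_square)
  qed
qed

lemma continuous_on_reg: "0 < e \<Longrightarrow> continuous_on cube (\<lambda>x. reg e x ^ m)"
  using periodic_partialD(1)[OF periodic_partial_reg] .

text \<open>A periodic counterpart of the radial field x / |x|^(2n+2): near the origin \<omega>
  behaves like |x|^2 / 4 and sin x_j like x_j.\<close>

definition G :: "real \<Rightarrow> nat \<Rightarrow> 'n \<Rightarrow> real ^ 'n \<Rightarrow> real" where
  "G e n j x = reg e x ^ Suc n * sin (x $ j)"

definition DG :: "real \<Rightarrow> nat \<Rightarrow> 'n \<Rightarrow> 'n \<Rightarrow> real ^ 'n \<Rightarrow> real" where
  "DG e n i j x = (if j = i then reg e x ^ Suc n * cos (x $ i) else 0)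
     - real (Suc n) / 2 * (sin (x $ i) * sin (x $ j)) * reg e x ^ Suc (Suc n)"

lemma periodic_partial_G:
  assumes "0 < e"
  shows "periodic_partial i (G e n j) (DG e n i j)"
  unfolding G_def[abs_def]
  by (rule periodic_partial_cong[OF periodic_partial_mult[OF periodic_partial_reg[OF assms] periodic_partial_sin]])
    (auto simp: DG_def field_simps)

section \<open>Divergence of the field and integrability of negative powers of \<omega>\<close>

lemma sum_cos: "(\<Sum>j\<in>UNIV. cos ((x :: real ^ 'n) $ j)) = real CARD('n) - 2 * \<omega> x"
proof -
  have "cos t = 1 - 2 * (sin (t / 2))\<^sup>2" for t :: real
    using cos_double_sin[of "t / 2"] by simp
  then show ?thesis by (simp add: \<omega>_def sum_subtractf sum_distrib_left)
qed

text \<open>Enters through sin^2 t = 4 (s^2 - s^4) with s = sin (t / 2): it measures by how much the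
  squared length of the vector of sines falls short of 4 \<omega>.\<close>

definition S4 :: "real ^ 'n \<Rightarrow> real" where
  "S4 x = (\<Sum>j\<in>UNIV. (sin (x $ j / 2)) ^ 4)"

lemma sum_sin2: "(\<Sum>j\<in>UNIV. (sin (x $ j))\<^sup>2) = 4 * (\<omega> x - S4 x)"
proof -
  have *: "(sin t)\<^sup>2 = 4 * ((sin (t / 2))\<^sup>2 - (sin (t / 2)) ^ 4)" for t :: real
  proof -
    have "(sin t)\<^sup>2 = 4 * (sin (t / 2))\<^sup>2 * (cos (t / 2))\<^sup>2"
      using sin_double[of "t / 2"] by (simp add: power_mult_distrib)
    then show ?thesis by (simp only: cos_squared_eq) (simp add: algebra_simps power4_eq_xxxx power2_eq_square)
  qed
  have "(\<Sum>j\<in>UNIV. (sin (x $ j))\<^sup>2) = (\<Sum>j\<in>UNIV. 4 * ((sin (x $ j / 2))\<^sup>2 - (sin (x $ j / 2)) ^ 4))"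
    by (intro sum.cong refl *)
  then show ?thesis by (simp add: \<omega>_def S4_def sum_subtractf sum_distrib_left)
qed

lemma S4_nonneg: "0 \<le> S4 x"
  by (simp add: S4_def sum_nonneg)

text \<open>Cauchy-Schwarz against the vector of ones. This gain is the source of the term with
  \<kappa> / d in \<open>pointwise_bound\<close> and thereby of the numerator of
  \<open>C2\<close>.\<close>

lemma S4_ge: "(\<omega> x)\<^sup>2 / real CARD('n) \<le> S4 (x :: real ^ 'n)"
proof -
  have "(\<Sum>j\<in>UNIV. (sin (x $ j / 2))\<^sup>2 * 1)\<^sup>2 \<le> (\<Sum>j\<in>UNIV. ((sin (x $ j / 2))\<^sup>2)\<^sup>2) * (\<Sum>j\<in>(UNIV :: 'n set). 1\<^sup>2)"
    by (rule Cauchy_Schwarz_ineq_sum)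
  then show ?thesis by (simp add: \<omega>_def S4_def field_simps flip: power_mult)
qed

lemma div_G:
  "(\<Sum>i\<in>UNIV. DG e n i i x) = reg e x ^ Suc n * (real CARD('n) - 2 * \<omega> x)
     - 2 * real (Suc n) * (\<omega> x - S4 x) * reg e (x :: real ^ 'n) ^ Suc (Suc n)"
proof -
  have "(\<Sum>i\<in>UNIV. DG e n i i x) = reg e x ^ Suc n * (\<Sum>i\<in>UNIV. cos (x $ i))
     - real (Suc n) / 2 * reg e x ^ Suc (Suc n) * (\<Sum>i\<in>UNIV. (sin (x $ i))\<^sup>2)"
    by (simp add: DG_def sum_subtractf sum_distrib_left power2_eq_square mult_ac)
  then show ?thesis unfolding sum_cos sum_sin2 by (simp add: mult_ac del: power_Suc of_nat_Suc)
qed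

lemma set_integral_mono_Q:
  fixes f g :: "real ^ 'n \<Rightarrow> real"
  assumes "continuous_on cube f" "continuous_on cube g" "\<And>x. x \<in> Q \<Longrightarrow> f x \<le> g x"
  shows "(LINT x:Q|lborel. f x) \<le> (LINT x:Q|lborel. g x)"
  using assms by (intro set_integral_mono set_integrable_Q)

lemma set_integral_sum:
  fixes f :: "'i \<Rightarrow> 'a \<Rightarrow> real"
  assumes "\<And>i. i \<in> I \<Longrightarrow> set_integrable M A (f i)"
  shows "(LINT x:A|M. \<Sum>i\<in>I. f i x) = (\<Sum>i\<in>I. LINT x:A|M. f i x)"
  using assms unfolding set_lebesgue_integral_def set_integrable_def scaleR_sum_right
  by (rule Bochner_Integration.integral_sum)

text \<open>The divergence of \<open>G e m\<close> integrates to zero and, with V =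
  \<open>reg e x\<close>, is at least (d - 2 (m + 1)) V^(m+1) - 2 V^m. As d exceeds 2 (m + 1), each
  further power of V costs at most a factor 2, uniformly in \<open>e\<close>.\<close>

lemma integral_reg_le:
  assumes e: "0 < e" and m: "2 * m < CARD('n)"
  shows "(LINT x:Q|lborel. reg e (x :: real ^ 'n) ^ m) \<le> 2 ^ m * measure lborel (Q :: (real ^ 'n) set)"
  using m
proof (induction m)
  case 0
  then show ?case by (simp add: set_lebesgue_integral_def)
next
  case (Suc m)
  have c: "continuous_on cube (\<lambda>x :: real ^ 'n. reg e x ^ m)" for m by (rule continuous_on_reg[OF e])
  have "periodic_partial i (G e m i) (DG e m i i)" for i :: 'n
    by (rule periodic_partial_G[OF e])
  note DG = periodic_partialD(2)[OF this] integral_periodic_partial[OF this]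
  have "(LINT x:Q|lborel. reg e (x :: real ^ 'n) ^ Suc m - 2 * reg e x ^ m) \<le> (LINT x:Q|lborel. (\<Sum>i\<in>UNIV. DG e m i i (x :: real ^ 'n)))"
  proof (rule set_integral_mono_Q)
    fix x :: "real ^ 'n" 
    define V where "V = reg e x"
    have V: "0 < V" "V * \<omega> x \<le> 1" using reg_bounds[OF e] by (auto simp: V_def)
    have "V ^ Suc m * \<omega> x \<le> V ^ m"
      using mult_left_mono[OF V(2), of "V ^ m"] V(1) by (simp add: mult_ac)
    moreover have "V ^ Suc (Suc m) * (\<omega> x - S4 x) \<le> V ^ Suc m"
    proof -
      have "V * (\<omega> x - S4 x) \<le> 1" using V S4_nonneg[of x] by (simp add: algebra_simps) (smt (verit) mult_nonneg_nonneg)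
      from mult_left_mono[OF this, of "V ^ Suc m"] V(1) show ?thesis by (simp add: mult_ac)
    qed
    from mult_left_mono[OF this, of "2 * real (Suc m)"]
    have "2 * real (Suc m) * (V ^ Suc (Suc m) * (\<omega> x - S4 x)) \<le> 2 * real (Suc m) * V ^ Suc m" by simp
    moreover have "V ^ Suc m * (2 * real (Suc m) + 1) \<le> V ^ Suc m * real CARD('n)"
      using Suc.prems V(1) by (intro mult_left_mono) auto
    ultimately have "V ^ Suc m - 2 * V ^ m \<le> V ^ Suc m * (real CARD('n) - 2 * \<omega> x)
       - 2 * real (Suc m) * (\<omega> x - S4 x) * V ^ Suc (Suc m)"
      by (simp only: algebra_simps)
    then show "reg e x ^ Suc m - 2 * reg e x ^ m \<le> (\<Sum>i\<in>UNIV. DG e m i i x)"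
      unfolding div_G V_def .
  qed (auto intro!: continuous_intros c DG(1) simp del: power_Suc)
  also have "\<dots> = 0"
    by (subst set_integral_sum[OF set_integrable_Q[OF DG(1)]]) (simp only: DG(2) sum.neutral_const)
  also have "(LINT x:Q|lborel. reg e (x :: real ^ 'n) ^ Suc m - 2 * reg e x ^ m)
      = (LINT x:Q|lborel. reg e (x :: real ^ 'n) ^ Suc m) - 2 * (LINT x:Q|lborel. reg e (x :: real ^ 'n) ^ m)"
    by (subst set_integral_diff(2)) (auto intro!: set_integrable_Q continuous_intros c simp del: power_Suc)
  finally have "(LINT x:Q|lborel. reg e (x :: real ^ 'n) ^ Suc m) \<le> 2 * (LINT x:Q|lborel. reg e (x :: real ^ 'n) ^ m)"
    by linarith
  also have "\<dots> \<le> 2 * (2 ^ m * measure lborel (Q :: (real ^ 'n) set))"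
    using Suc by (intro mult_left_mono) auto
  finally show ?case by simp
qed

lemma reg_tendsto:
  assumes "\<omega> x \<noteq> 0"
  shows "(\<lambda>k. reg (inverse (real (Suc k))) x) \<longlonglongrightarrow> inverse (\<omega> x)"
proof -
  have "(\<lambda>k. \<omega> x + inverse (real (Suc k))) \<longlonglongrightarrow> \<omega> x + 0"
    by (intro tendsto_intros LIMSEQ_inverse_real_of_nat)
  from tendsto_inverse[OF this] assms show ?thesis by (simp add: reg_def)
qed

lemma reg_measurable [measurable]: "reg e \<in> borel_measurable borel"
  unfolding reg_def[abs_def] by measurable

text \<open>Fatou's lemma along e = 1 / (k + 1); the bound in \<open>integral_reg_le\<close> does
  not depend on \<open>e\<close>.\<close>

lemma integrable_\<omega>_power:
  assumes m: "2 * m < CARD('n)"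
  shows "set_integrable lborel Q (\<lambda>x :: real ^ 'n. inverse (\<omega> x) ^ m)"
proof -
  define C where "C = 2 ^ m * measure lborel (Q :: (real ^ 'n) set)"
  define f where "f x = indicat_real Q x * inverse (\<omega> x) ^ m" for x :: "real ^ 'n"
  define f' where "f' k x = indicat_real Q x * reg (inverse (real (Suc k))) x ^ m" for k and x :: "real ^ 'n"
  have [measurable]: "f \<in> borel_measurable borel" "f' k \<in> borel_measurable borel" for k
    unfolding f_def[abs_def] f'_def[abs_def] by measurable
  have f'0: "0 \<le> f' k x" for k x
    using reg_bounds(1)[of "inverse (real (Suc k))" x] by (simp add: f'_def)
  have "(\<integral>\<^sup>+x. ennreal (f x) \<partial>lborel) \<le> (\<integral>\<^sup>+x. liminf (\<lambda>k. ennreal (f' k x)) \<partial>lborel)"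
  proof (rule nn_integral_mono)
    fix x :: "real ^ 'n"
    show "ennreal (f x) \<le> liminf (\<lambda>k. ennreal (f' k x))"
    \<comment> \<open>Where \<omega> vanishes the regularized powers blow up, but
      \<open>inverse 0 = 0\<close> makes \<open>f x\<close> zero for positive \<open>m\<close>, so
      the inequality is trivial there; elsewhere there is convergence.\<close>
    proof (cases "\<omega> x = 0 \<and> m > 0")
      case True
      then show ?thesis by (simp add: f_def zero_power)
    next
      case False
      have "(\<lambda>k. f' k x) \<longlonglongrightarrow> f x"
      proof (cases "m = 0")
        case True
        then show ?thesis by (simp add: f_def f'_def)
      next
        case m0: False
        with False have "\<omega> x \<noteq> 0" by simp
        then show ?thesis
          unfolding f_def f'_def by (intro tendsto_mult tendsto_const tendsto_power reg_tendsto)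
      qed
      then show ?thesis
        by (intro eq_refl lim_imp_Liminf[symmetric] tendsto_ennrealI) simp_all
    qed
  qed
  also have "\<dots> \<le> liminf (\<lambda>k. \<integral>\<^sup>+x. ennreal (f' k x) \<partial>lborel)"
    by (rule nn_integral_liminf) measurable
  also have "\<dots> \<le> liminf (\<lambda>k. ennreal C)"
  proof (rule Liminf_mono, rule always_eventually, rule allI)
    fix k
    have e: "0 < inverse (real (Suc k))" by simp
    have "integrable lborel (f' k)"
      using set_integrable_Q[OF continuous_on_reg[OF e]] by (simp add: set_integrable_def f'_def[abs_def])
    then have "(\<integral>\<^sup>+x. ennreal (f' k x) \<partial>lborel) = ennreal (integral\<^sup>L lborel (f' k))"
      by (intro nn_integral_eq_integral) (auto simp: f'0)
    also have "integral\<^sup>L lborel (f' k) \<le> C"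
      using integral_reg_le[OF e m] by (simp add: C_def set_lebesgue_integral_def f'_def[abs_def])
    finally show "(\<integral>\<^sup>+x. ennreal (f' k x) \<partial>lborel) \<le> ennreal C" by (simp add: ennreal_leI)
  qed
  also have "\<dots> < \<infinity>" by (simp add: Liminf_const)
  finally have "integrable lborel f"
    by (intro integrableI_nonneg) (auto simp: f_def \<omega>_nonneg)
  then show ?thesis by (simp add: set_integrable_def f_def[abs_def])
qed

lemma integrable_mult_\<omega>_power:
  fixes f :: "real ^ 'n \<Rightarrow> real"
  assumes f: "continuous_on cube f" and m: "2 * m < CARD('n)"
  shows "set_integrable lborel Q (\<lambda>x. f x * inverse (\<omega> x) ^ m)"
proof -
  obtain C where C: "\<And>x. x \<in> cube \<Longrightarrow> norm (f x) \<le> C"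
    using compact_imp_bounded[OF compact_continuous_image[OF f compact_cube]]
    by (auto simp: bounded_iff)
  have "set_integrable lborel Q (\<lambda>x :: real ^ 'n. C * inverse (\<omega> x) ^ m)"
    using integrable_\<omega>_power[OF m] by simp
  then show ?thesis
  proof (rule set_integrable_bound)
    have "set_borel_measurable lborel Q f"
      using set_integrable_Q[OF f] unfolding set_integrable_def set_borel_measurable_def by auto
    then show "set_borel_measurable lborel Q (\<lambda>x. f x * inverse (\<omega> x) ^ m)"
      unfolding set_borel_measurable_def by (simp add: mult.assoc[symmetric])
    show "AE x in lborel. x \<in> Q \<longrightarrow> norm (f x * inverse (\<omega> x) ^ m) \<le> norm (C * inverse (\<omega> x) ^ m)"
      using C Q_subset_cube
      by (intro AE_I2) (auto simp: abs_mult \<omega>_nonneg intro!: mult_right_mono order_trans[OF _ abs_ge_self])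
  qed
qed

subsection \<open>The divergence identity\<close>

text \<open>A real smooth periodic function presented as the table of its derivatives:
  \<open>D []\<close> is the function itself and the head of the list is the direction
  differentiated last. It will be instantiated with the real and imaginary parts of the iterated
  derivatives of \<psi>.\<close>

definition derivative_family :: "('n list \<Rightarrow> real ^ 'n \<Rightarrow> real) \<Rightarrow> bool" where
  "derivative_family D \<longleftrightarrow> (\<forall>is i. periodic_partial i (D is) (D (i # is)))"

lemma derivative_familyD:
  assumes "derivative_family D"
  shows "periodic_partial i (D is) (D (i # is))" "continuous_on cube (D is)"
  using assms periodic_partialD(1) unfolding derivative_family_def by blast+

lemma derivative_family_swap:
  assumes "derivative_family D" "x \<in> Q"
  shows "D (i # j # is) x = D (j # i # is) x"
  using mixed_partials derivative_familyD(1)[OF assms(1)] assms(2) by metis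

definition lap :: "('n list \<Rightarrow> real ^ 'n \<Rightarrow> real) \<Rightarrow> real ^ 'n \<Rightarrow> real" where
  "lap D x = (\<Sum>i\<in>UNIV. D [i, i] x)"

definition grad_sq :: "('n list \<Rightarrow> real ^ 'n \<Rightarrow> real) \<Rightarrow> real ^ 'n \<Rightarrow> real" where
  "grad_sq D x = (\<Sum>i\<in>UNIV. (D [i] x)\<^sup>2)"

lemma continuous_on_lap_grad_sq:
  assumes "derivative_family D"
  shows "continuous_on cube (lap D)" "continuous_on cube (grad_sq D)"
  unfolding lap_def[abs_def] grad_sq_def[abs_def]
  by (intro continuous_intros derivative_familyD(2)[OF assms])+

lemma set_integral_cong_Q:
  fixes f g :: "real ^ 'n \<Rightarrow> real"
  shows "(\<And>x. x \<in> Q \<Longrightarrow> f x = g x) \<Longrightarrow> (LINT x:Q|lborel. f x) = (LINT x:Q|lborel. g x)"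
  by (rule set_lebesgue_integral_cong) auto

text \<open>Integrate d_i (D_i D_jj) - d_j (D_i D_ij) over the torus, where indices on D denote
  derivatives; the third-order terms cancel by symmetry of mixed partials.\<close>

lemma integral_hessian:
  fixes D :: "'n list \<Rightarrow> real ^ 'n \<Rightarrow> real"
  assumes D: "derivative_family D"
  shows "(LINT x:Q|lborel. D [i, i] x * D [j, j] x) = (LINT x:Q|lborel. (D [i, j] x)\<^sup>2)"
proof -
  note PD = derivative_familyD(1)[OF D] and c = derivative_familyD(2)[OF D]
  have "(LINT x:Q|lborel. (D [i, i] x * D [j, j] x + D [i] x * D [i, j, j] x)
      - (D [j, i] x * D [i, j] x + D [i] x * D [j, i, j] x)) = 0"
    using integral_periodic_partial[OF periodic_partial_mult[OF PD[of i "[i]"] PD[of i "[j, j]"]]]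
      integral_periodic_partial[OF periodic_partial_mult[OF PD[of j "[i]"] PD[of j "[i, j]"]]]
    by (subst set_integral_diff(2)) (auto intro!: set_integrable_Q continuous_intros c)
  also have "(LINT x:Q|lborel. (D [i, i] x * D [j, j] x + D [i] x * D [i, j, j] x)
      - (D [j, i] x * D [i, j] x + D [i] x * D [j, i, j] x))
    = (LINT x:Q|lborel. D [i, i] x * D [j, j] x - (D [i, j] x)\<^sup>2)"
    using derivative_family_swap[OF D]
    by (intro set_integral_cong_Q) (simp add: power2_eq_square)
  also have "\<dots> = (LINT x:Q|lborel. D [i, i] x * D [j, j] x) - (LINT x:Q|lborel. (D [i, j] x)\<^sup>2)"
    by (subst set_integral_diff(2)) (auto intro!: set_integrable_Q continuous_intros c)
  finally show ?thesis by simp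
qed

text \<open>The unweighted inequality that ends the iteration. Wirtinger bounds each first
  derivative by a diagonal Hessian entry; adding the off-diagonal squares gives the full Hessian,
  whose integral is that of the squared Laplacian.\<close>

lemma integral_grad_sq_le:
  fixes D :: "'n list \<Rightarrow> real ^ 'n \<Rightarrow> real"
  assumes D: "derivative_family D"
  shows "(LINT x:Q|lborel. grad_sq D x) \<le> (LINT x:Q|lborel. (lap D x)\<^sup>2)"
proof -
  note PD = derivative_familyD(1)[OF D] and c = derivative_familyD(2)[OF D]
  have "(LINT x:Q|lborel. grad_sq D x) = (\<Sum>i\<in>UNIV. LINT x:Q|lborel. (D [i] x)\<^sup>2)"
    unfolding grad_sq_def by (intro set_integral_sum set_integrable_Q continuous_intros c)
  also have "\<dots> \<le> (\<Sum>i\<in>UNIV. LINT x:Q|lborel. (D [i, i] x)\<^sup>2)"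
    by (rule sum_mono, rule wirtinger_partial[OF PD[of _ "[]"] PD])
  also have "\<dots> \<le> (\<Sum>i\<in>UNIV. \<Sum>j\<in>UNIV. LINT x:Q|lborel. (D [i, j] x)\<^sup>2)"
  proof (rule sum_mono)
    fix i :: 'n
    have nonneg: "0 \<le> (LINT x:Q|lborel. (D [i, j] x)\<^sup>2)" for j
      unfolding set_lebesgue_integral_def by (intro integral_nonneg_AE AE_I2) auto
    show "(LINT x:Q|lborel. (D [i, i] x)\<^sup>2) \<le> (\<Sum>j\<in>UNIV. LINT x:Q|lborel. (D [i, j] x)\<^sup>2)"
      using nonneg by (intro member_le_sum) auto
  qed
  also have "\<dots> = (\<Sum>i\<in>UNIV. \<Sum>j\<in>UNIV. LINT x:Q|lborel. D [i, i] x * D [j, j] x)"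
    by (simp add: integral_hessian[OF D])
  also have "\<dots> = (LINT x:Q|lborel. \<Sum>i\<in>UNIV. \<Sum>j\<in>UNIV. D [i, i] x * D [j, j] x)"
    by (subst set_integral_sum, auto intro!: set_integrable_Q continuous_intros c)
      (subst set_integral_sum, auto intro!: set_integrable_Q continuous_intros c)
  also have "\<dots> = (LINT x:Q|lborel. (lap D x)\<^sup>2)"
    by (simp add: lap_def power2_eq_square sum_product)
  finally show ?thesis .
qed

text \<open>The integrand is the divergence of \<open>\<nabla>u (g \<cdot> \<nabla>u) - g |\<nabla>u|\<^sup>2 / 2\<close>; the terms with the
  full Hessian cancel by its symmetry.\<close>

lemma integral_pohozaev:
  fixes D :: "'n list \<Rightarrow> real ^ 'n \<Rightarrow> real"
  assumes D: "derivative_family D"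
    and G: "\<And>i j. periodic_partial i (g j) (dg i j)"
  shows "(LINT x:Q|lborel. lap D x * (\<Sum>j\<in>UNIV. g j x * D [j] x)
      + (\<Sum>i\<in>UNIV. \<Sum>j\<in>UNIV. D [i] x * dg i j x * D [j] x)
      - (\<Sum>i\<in>UNIV. dg i i x) * grad_sq D x / 2) = 0"
proof -
  note PD = derivative_familyD(1)[OF D]
  \<comment> \<open>The i-th summand of the divergence, expanded exactly as the sum and product
    rules for \<open>periodic_partial\<close> produce it.\<close>
  define h where "h i x = D [i, i] x * (\<Sum>j\<in>UNIV. g j x * D [j] x)
      + D [i] x * (\<Sum>j\<in>UNIV. dg i j x * D [j] x + g j x * D [i, j] x)
      + (- 1 / 2) * (dg i i x * (\<Sum>j\<in>UNIV. D [j] x * D [j] x)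
      + g i x * (\<Sum>j\<in>UNIV. D [i, j] x * D [j] x + D [j] x * D [i, j] x))" for i x
  have h: "periodic_partial i (\<lambda>x. D [i] x * (\<Sum>j\<in>UNIV. g j x * D [j] x)
      + (- 1 / 2) * (g i x * (\<Sum>j\<in>UNIV. D [j] x * D [j] x))) (h i)" for i
    unfolding h_def
    by (intro periodic_partial_add periodic_partial_mult periodic_partial_cmult periodic_partial_sum PD G)
  have "0 = (LINT x:Q|lborel. \<Sum>i\<in>UNIV. h i x)"
    using integral_periodic_partial[OF h] periodic_partialD(2)[OF h]
    by (simp add: set_integral_sum set_integrable_Q)
  also have "\<dots> = (LINT x:Q|lborel. lap D x * (\<Sum>j\<in>UNIV. g j x * D [j] x)
      + (\<Sum>i\<in>UNIV. \<Sum>j\<in>UNIV. D [i] x * dg i j x * D [j] x)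
      - (\<Sum>i\<in>UNIV. dg i i x) * grad_sq D x / 2)"
  proof (rule set_integral_cong_Q)
    fix x :: "real ^ 'n" assume x: "x \<in> Q"
    have "(\<Sum>i\<in>UNIV. \<Sum>j\<in>UNIV. g i x * D [i, j] x * D [j] x) = (\<Sum>i\<in>UNIV. \<Sum>j\<in>UNIV. g j x * D [j, i] x * D [i] x)"
      by (rule sum.swap)
    also have "\<dots> = (\<Sum>i\<in>UNIV. \<Sum>j\<in>UNIV. D [i] x * (g j x * D [i, j] x))"
      using derivative_family_swap[OF D x, of _ _ "[]"] by (simp add: mult_ac)
    finally have cancel: "(\<Sum>i\<in>UNIV. \<Sum>j\<in>UNIV. D [i] x * (g j x * D [i, j] x))
        = (\<Sum>i\<in>UNIV. \<Sum>j\<in>UNIV. g i x * D [i, j] x * D [j] x)" by simp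
    have hi: "h i x = D [i, i] x * (\<Sum>j\<in>UNIV. g j x * D [j] x)
        + (\<Sum>j\<in>UNIV. D [i] x * dg i j x * D [j] x)
        + (\<Sum>j\<in>UNIV. D [i] x * (g j x * D [i, j] x))
        - dg i i x * (grad_sq D x / 2)
        - (\<Sum>j\<in>UNIV. g i x * D [i, j] x * D [j] x)" for i
      unfolding h_def grad_sq_def
      by (simp add: sum.distrib sum_distrib_left sum_divide_distrib distrib_left
          sum_negf power2_eq_square mult_ac)
    have "(\<Sum>i\<in>UNIV. h i x) = (\<Sum>i\<in>UNIV. D [i, i] x) * (\<Sum>j\<in>UNIV. g j x * D [j] x)
        + (\<Sum>i\<in>UNIV. \<Sum>j\<in>UNIV. D [i] x * dg i j x * D [j] x)
        + (\<Sum>i\<in>UNIV. \<Sum>j\<in>UNIV. D [i] x * (g j x * D [i, j] x))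
        - (\<Sum>i\<in>UNIV. dg i i x) * grad_sq D x / 2
        - (\<Sum>i\<in>UNIV. \<Sum>j\<in>UNIV. g i x * D [i, j] x * D [j] x)"
      unfolding hi sum.distrib sum_subtractf sum_distrib_right[symmetric] by simp
    then show "(\<Sum>i\<in>UNIV. h i x) = lap D x * (\<Sum>j\<in>UNIV. g j x * D [j] x)
      + (\<Sum>i\<in>UNIV. \<Sum>j\<in>UNIV. D [i] x * dg i j x * D [j] x)
      - (\<Sum>i\<in>UNIV. dg i i x) * grad_sq D x / 2"
      unfolding lap_def cancel by simp
  qed
  finally show ?thesis by simp
qed

text \<open>Bounds the integrand of \<open>integral_pohozaev\<close> for the field \<open>G\<close>,
  with \<open>L\<close> for the Laplacian and \<open>p\<close> for the gradient. The mixed term is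
  split by Young's inequality with weight \<eta>; collecting all multiples of V^(n+2) (\<omega> -
  \<open>S4\<close>) P then leaves the coefficient \<kappa>.\<close>

lemma pointwise_bound:
  fixes x :: "real ^ 'n" and p :: "'n \<Rightarrow> real" and L :: real
  assumes e: "0 < e" and n: "8 + 6 * n \<le> CARD('n)"
  defines "d \<equiv> real CARD('n)" and "P \<equiv> \<Sum>j\<in>UNIV. (p j)\<^sup>2" and "V \<equiv> reg e x"
  defines "\<eta> \<equiv> (d + 2 * real n) / 4"
  defines "\<kappa> \<equiv> \<eta> - (real n + 1)"
  shows "L * (\<Sum>j\<in>UNIV. G e n j x * p j) + (\<Sum>i\<in>UNIV. \<Sum>j\<in>UNIV. p i * DG e n i j x * p j)
      - (\<Sum>i\<in>UNIV. DG e n i i x) * P / 2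
    \<le> L\<^sup>2 * V ^ n / \<eta> - \<eta> * (P * V ^ Suc n) + \<omega> x * V ^ Suc n * P
      - \<kappa> / d * ((\<omega> x)\<^sup>2 * V ^ Suc (Suc n) * P)"
proof -
  define F where "F = (\<Sum>j\<in>UNIV. sin (x $ j) * p j)"
  define W where "W = V ^ n"
  have V: "0 < V" "V * \<omega> x \<le> 1" using reg_bounds[OF e] by (auto simp: V_def)
  then have W: "0 < W" by (simp add: W_def)
  have P: "0 \<le> P" by (simp add: P_def sum_nonneg)
  have dn: "8 + 6 * real n \<le> d" using n unfolding d_def by linarith
  have \<eta>: "0 < \<eta>" "2 * (real n + 1) \<le> \<eta>" using dn by (auto simp: \<eta>_def)
  then have \<kappa>: "0 \<le> \<kappa>" by (simp add: \<kappa>_def)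
  have T1: "L * (\<Sum>j\<in>UNIV. G e n j x * p j) = L * F * V * W"
    by (simp add: G_def F_def V_def W_def sum_distrib_left sum_distrib_right mult_ac)
  have T2: "(\<Sum>i\<in>UNIV. \<Sum>j\<in>UNIV. p i * DG e n i j x * p j)
      = V * W * (\<Sum>i\<in>UNIV. cos (x $ i) * (p i)\<^sup>2) - (real n + 1) / 2 * F\<^sup>2 * V\<^sup>2 * W"
  proof -
    have "(\<Sum>j\<in>UNIV. p i * DG e n i j x * p j)
      = V * W * (cos (x $ i) * (p i)\<^sup>2) - (real n + 1) / 2 * V\<^sup>2 * W * F * (sin (x $ i) * p i)" for i
    proof -
      have "p i * DG e n i j x * p j = (if j = i then V * W * (cos (x $ i) * (p i)\<^sup>2) else 0)
          - (real n + 1) / 2 * V\<^sup>2 * W * (sin (x $ i) * p i) * (sin (x $ j) * p j)" for j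
        by (simp add: DG_def V_def[symmetric] W_def algebra_simps power2_eq_square)
      then show ?thesis
        by (simp only: sum_subtractf sum_distrib_left[symmetric] F_def[symmetric]) simp
    qed
    then show ?thesis
      by (simp only: sum_subtractf sum_distrib_left[symmetric] F_def[symmetric])
        (simp add: power2_eq_square mult_ac)
  qed
  have T3: "(\<Sum>i\<in>UNIV. DG e n i i x) = V * W * (d - 2 * \<omega> x) - 2 * (real n + 1) * (\<omega> x - S4 x) * V\<^sup>2 * W"
    unfolding div_G d_def V_def[symmetric] by (simp add: W_def power2_eq_square algebra_simps)
  have cosP: "V * W * (\<Sum>i\<in>UNIV. cos (x $ i) * (p i)\<^sup>2) \<le> V * W * P"
  proof (intro mult_left_mono)
    have "cos (x $ i) * (p i)\<^sup>2 \<le> 1 * (p i)\<^sup>2" for i by (intro mult_right_mono) auto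
    then show "(\<Sum>i\<in>UNIV. cos (x $ i) * (p i)\<^sup>2) \<le> P"
      unfolding P_def by (intro sum_mono) simp
  qed (use V W in simp)
  have "F\<^sup>2 \<le> (\<Sum>j\<in>UNIV. (sin (x $ j))\<^sup>2) * (\<Sum>j\<in>UNIV. (p j)\<^sup>2)"
    unfolding F_def by (rule Cauchy_Schwarz_ineq_sum)
  then have F2: "F\<^sup>2 \<le> 4 * (\<omega> x - S4 x) * P"
    by (simp add: sum_sin2 P_def)
  have amgm: "L * F * V * W \<le> L\<^sup>2 * W / \<eta> + \<eta> / 4 * F\<^sup>2 * V\<^sup>2 * W"
  proof -
    have "L\<^sup>2 * W / \<eta> + \<eta> / 4 * F\<^sup>2 * V\<^sup>2 * W - L * F * V * W = W / \<eta> * (L - \<eta> * F * V / 2)\<^sup>2"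
      using \<eta>(1) by (simp add: field_simps power2_eq_square)
    also have "\<dots> \<ge> 0" using W \<eta> by simp
    finally show ?thesis by simp
  qed
  \<comment> \<open>The dimension condition d >= 8 + 6 n says precisely that \<eta> / 4 - (n + 1) /
    2 is nonnegative, which allows the radial part F^2 to be replaced by its upper bound.\<close>
  have F3: "(\<eta> / 4 - (real n + 1) / 2) * V\<^sup>2 * W * F\<^sup>2
      \<le> (\<eta> / 4 - (real n + 1) / 2) * V\<^sup>2 * W * (4 * (\<omega> x - S4 x) * P)"
    using \<eta> W by (intro mult_left_mono F2) auto
  have S: "\<kappa> * V\<^sup>2 * W * P * ((\<omega> x)\<^sup>2 / d) \<le> \<kappa> * V\<^sup>2 * W * P * S4 x"
    using \<kappa> W P S4_ge[of x] by (intro mult_left_mono) (auto simp: d_def)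
  have Vw: "\<kappa> * V * W * P * (V * \<omega> x) \<le> \<kappa> * V * W * P * 1"
    using \<kappa> W P V by (intro mult_left_mono) auto
  \<comment> \<open>This equation determines \<eta>: the coefficient left over for V^(n+1) P is the
    negative of the Young weight.\<close>
  have \<eta>d: "1 - d / 2 + \<kappa> = - \<eta>" by (simp add: \<kappa>_def \<eta>_def field_simps)
  have "L * (\<Sum>j\<in>UNIV. G e n j x * p j) + (\<Sum>i\<in>UNIV. \<Sum>j\<in>UNIV. p i * DG e n i j x * p j)
      - (\<Sum>i\<in>UNIV. DG e n i i x) * P / 2
    \<le> L\<^sup>2 * W / \<eta> + (\<eta> / 4 - (real n + 1) / 2) * V\<^sup>2 * W * (4 * (\<omega> x - S4 x) * P) + V * W * P
      - (V * W * (d - 2 * \<omega> x) - 2 * (real n + 1) * (\<omega> x - S4 x) * V\<^sup>2 * W) * P / 2"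
    unfolding T1 T2 T3 using amgm F3 cosP by (simp add: left_diff_distrib) argo
  also have "\<dots> = L\<^sup>2 * W / \<eta> + \<kappa> * V\<^sup>2 * W * P * \<omega> x - \<kappa> * V\<^sup>2 * W * P * S4 x
      + V * W * P * (1 - d / 2 + \<omega> x)"
    by (simp add: \<kappa>_def algebra_simps add_divide_distrib diff_divide_distrib)
  also have "\<dots> \<le> L\<^sup>2 * W / \<eta> + \<kappa> * V * W * P - \<kappa> * V\<^sup>2 * W * P * ((\<omega> x)\<^sup>2 / d)
      + V * W * P * (1 - d / 2 + \<omega> x)"
    using S Vw by (simp add: power2_eq_square mult_ac)
  also have "\<dots> = L\<^sup>2 * W / \<eta> + V * W * P * (1 - d / 2 + \<kappa>) - \<kappa> * V\<^sup>2 * W * P * ((\<omega> x)\<^sup>2 / d)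
      + V * W * P * \<omega> x"
    by (simp add: algebra_simps)
  also have "\<dots> = L\<^sup>2 * V ^ n / \<eta> - \<eta> * (P * V ^ Suc n) + \<omega> x * V ^ Suc n * P
      - \<kappa> / d * ((\<omega> x)\<^sup>2 * V ^ Suc (Suc n) * P)"
    unfolding \<eta>d by (simp add: W_def power2_eq_square mult_ac)
  finally show ?thesis .
qed

lemma regularized_step:
  fixes D :: "'n list \<Rightarrow> real ^ 'n \<Rightarrow> real"
  assumes D: "derivative_family D" and e: "0 < e" and n: "8 + 6 * n \<le> CARD('n)"
  defines "d \<equiv> real CARD('n)"
  defines "\<eta> \<equiv> (d + 2 * real n) / 4"
  defines "\<kappa> \<equiv> \<eta> - (real n + 1)"
  shows "0 \<le> (LINT x:Q|lborel. (lap D x)\<^sup>2 * reg e x ^ n / \<eta> - \<eta> * (grad_sq D x * reg e x ^ Suc n)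
      + \<omega> x * reg e x ^ Suc n * grad_sq D x
      - \<kappa> / d * ((\<omega> x)\<^sup>2 * reg e x ^ Suc (Suc n) * grad_sq D x))"
proof -
  note c = derivative_familyD(2)[OF D] continuous_on_lap_grad_sq[OF D] continuous_on_reg[OF e]
    periodic_partialD(1)[OF periodic_partial_\<omega>] periodic_partialD(1,2)[OF periodic_partial_G[OF e]]
  have \<eta>: "\<eta> \<noteq> 0" "d \<noteq> 0" using n by (simp_all add: \<eta>_def d_def)
  show ?thesis
  proof (rule ord_eq_le_trans[OF integral_pohozaev[OF D periodic_partial_G[OF e, where n = n], symmetric]],
      rule set_integral_mono_Q)
    fix x :: "real ^ 'n"
    show "lap D x * (\<Sum>j\<in>UNIV. G e n j x * D [j] x)
      + (\<Sum>i\<in>UNIV. \<Sum>j\<in>UNIV. D [i] x * DG e n i j x * D [j] x)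
      - (\<Sum>i\<in>UNIV. DG e n i i x) * grad_sq D x / 2 \<le> (lap D x)\<^sup>2 * reg e x ^ n / \<eta> - \<eta> * (grad_sq D x * reg e x ^ Suc n)
      + \<omega> x * reg e x ^ Suc n * grad_sq D x
      - \<kappa> / d * ((\<omega> x)\<^sup>2 * reg e x ^ Suc (Suc n) * grad_sq D x)"
      unfolding grad_sq_def \<kappa>_def \<eta>_def d_def by (rule pointwise_bound[OF e n])
  qed (use \<eta> in \<open>auto intro!: continuous_intros c simp del: power_Suc\<close>)
qed

subsection \<open>Removing the regularization and iterating\<close>

lemma AE_\<omega>_pos: "AE x in lborel. x \<in> (Q :: (real ^ 'n) set) \<longrightarrow> 0 < \<omega> x"
proof -
  have "AE x in lborel. x \<noteq> (0 :: real ^ 'n)"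
    using AE_lborel_singleton by blast
  then show ?thesis
    by eventually_elim (use \<omega>_nonneg \<omega>_eq_0_iff in \<open>auto simp: less_le\<close>)
qed

text \<open>Letting e -> 0 in \<open>regularized_step\<close> by dominated convergence gives 0 <= A
  / \<eta> - \<eta> B + (1 - \<kappa> / d) C for the integrals A, B, C of \<open>a\<close>,
  \<open>b\<close>, \<open>c\<close>; dividing by \<eta> produces the two constants.\<close>

lemma weighted_step:
  fixes D :: "'n list \<Rightarrow> real ^ 'n \<Rightarrow> real"
  assumes D: "derivative_family D" and n: "8 + 6 * n \<le> CARD('n)"
  shows "(LINT x:Q|lborel. grad_sq D x * inverse (\<omega> x) ^ Suc n)
    \<le> C1 (- int n) CARD('n) * (LINT x:Q|lborel. (lap D x)\<^sup>2 * inverse (\<omega> x) ^ n)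
      + C2 (- int n) CARD('n) * (LINT x:Q|lborel. grad_sq D x * inverse (\<omega> x) ^ n)"
proof -
  define d where "d = real CARD('n)"
  define \<eta> where "\<eta> = (d + 2 * real n) / 4"
  define \<kappa> where "\<kappa> = \<eta> - (real n + 1)"
  define a where "a x = (lap D x)\<^sup>2 * inverse (\<omega> x) ^ n" for x
  define b where "b x = grad_sq D x * inverse (\<omega> x) ^ Suc n" for x
  define c where "c x = grad_sq D x * inverse (\<omega> x) ^ n" for x
  define h where "h e x = (lap D x)\<^sup>2 * reg e x ^ n / \<eta> - \<eta> * (grad_sq D x * reg e x ^ Suc n)
      + \<omega> x * reg e x ^ Suc n * grad_sq D x
      - \<kappa> / d * ((\<omega> x)\<^sup>2 * reg e x ^ Suc (Suc n) * grad_sq D x)" for e x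
  have dn: "8 + 6 * real n \<le> d" using n unfolding d_def by linarith
  then have \<eta>: "0 < \<eta>" and \<kappa>: "0 \<le> \<kappa> / d" by (auto simp: \<eta>_def \<kappa>_def)
  have cont: "continuous_on cube (\<lambda>x. (lap D x)\<^sup>2)" "continuous_on cube (grad_sq D)"
    by (intro continuous_intros continuous_on_lap_grad_sq[OF D])+
  have int: "set_integrable lborel Q a" "set_integrable lborel Q b" "set_integrable lborel Q c"
    unfolding a_def b_def c_def by (intro integrable_mult_\<omega>_power cont; use n in simp)+
  have g0: "0 \<le> grad_sq D x" for x by (simp add: grad_sq_def sum_nonneg)
  define s where "s k x = indicat_real Q x * h (inverse (real (Suc k))) x" for k x
  define l where "l x = indicat_real Q x * (a x / \<eta> - \<eta> * b x + (1 - \<kappa> / d) * c x)" for x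
  \<comment> \<open>The majorant is the limit with all signs made positive; it dominates since
    \<open>reg e x\<close> is at most \<open>inverse (\<omega> x)\<close> off the origin.\<close>
  define w where "w x = indicat_real Q x * (a x / \<eta> + \<eta> * b x + (1 + \<kappa> / d) * c x)" for x
  have meas_l: "l \<in> borel_measurable lborel" and int_w: "integrable lborel w"
  proof -
    have "set_integrable lborel Q (\<lambda>x. a x / \<eta> - \<eta> * b x + (1 - \<kappa> / d) * c x)"
      "set_integrable lborel Q (\<lambda>x. a x / \<eta> + \<eta> * b x + (1 + \<kappa> / d) * c x)"
      using int by (auto intro!: set_integral_add set_integral_diff)
    then show "l \<in> borel_measurable lborel" "integrable lborel w"
      by (auto simp: set_integrable_def l_def[abs_def] w_def[abs_def])
  qed
  have meas_s: "s k \<in> borel_measurable lborel" for k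
  proof -
    have "0 < inverse (real (Suc k))" by simp
    from continuous_on_reg[OF this, of 1]
    have cr: "continuous_on cube (reg (inverse (real (Suc k))) :: real ^ 'n \<Rightarrow> real)"
      by (simp only: power_one_right)
    note c = cr continuous_on_lap_grad_sq[OF D] periodic_partialD(1)[OF periodic_partial_\<omega>]
    have "set_integrable lborel Q (h (inverse (real (Suc k))))"
      unfolding h_def using \<eta> dn
      by (auto intro!: set_integrable_Q continuous_intros c simp del: power_Suc of_nat_Suc)
    then show ?thesis by (auto simp: set_integrable_def s_def[abs_def])
  qed
  have ptw: "(\<lambda>k. s k x) \<longlonglongrightarrow> l x \<and> (\<forall>k. norm (s k x) \<le> w x)" if x: "x \<in> Q \<longrightarrow> 0 < \<omega> x" for x
  proof (cases "x \<in> Q")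
    case False
    then show ?thesis by (simp add: s_def l_def w_def)
  next
    case True
    with x have pos: "0 < \<omega> x" by simp
    define U where "U = inverse (\<omega> x)"
    have U: "0 < U" "\<omega> x * U = 1" using pos by (auto simp: U_def)
    have U1: "\<omega> x * U ^ Suc n = U ^ n" and U2: "(\<omega> x)\<^sup>2 * U ^ Suc (Suc n) = U ^ n"
      using U by (simp_all add: mult.assoc[symmetric] power2_eq_square mult.left_commute[of _ U])
        (metis mult.assoc mult.commute mult.right_neutral)
    have "(\<lambda>k. h (inverse (real (Suc k))) x) \<longlonglongrightarrow> (lap D x)\<^sup>2 * U ^ n / \<eta> - \<eta> * (grad_sq D x * U ^ Suc n)
      + \<omega> x * U ^ Suc n * grad_sq D x - \<kappa> / d * ((\<omega> x)\<^sup>2 * U ^ Suc (Suc n) * grad_sq D x)"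
      unfolding h_def U_def using pos \<eta> by (intro tendsto_intros reg_tendsto) auto
    also have "(lap D x)\<^sup>2 * U ^ n / \<eta> - \<eta> * (grad_sq D x * U ^ Suc n)
      + \<omega> x * U ^ Suc n * grad_sq D x - \<kappa> / d * ((\<omega> x)\<^sup>2 * U ^ Suc (Suc n) * grad_sq D x) = l x"
      unfolding U1 U2 using True by (simp add: l_def a_def b_def c_def U_def left_diff_distrib right_diff_distrib mult_ac)
    finally have lim: "(\<lambda>k. s k x) \<longlonglongrightarrow> l x" using True by (simp add: s_def)
    have "norm (s k x) \<le> w x" for k
    proof -
      define V where "V = reg (inverse (real (Suc k))) x"
      have e: "0 < inverse (real (Suc k))" by simp
      have V: "0 \<le> V" "V \<le> U"
        using reg_bounds(1)[OF e, of x] reg_le[OF e, of x] pos by (auto simp: V_def U_def)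
      have p: "V ^ m \<le> U ^ m" "0 \<le> V ^ m" for m using V by (auto intro: power_mono)
      have "(lap D x)\<^sup>2 * V ^ n / \<eta> \<le> a x / \<eta>"
        unfolding a_def U_def[symmetric] using \<eta> p by (intro divide_right_mono mult_left_mono) auto
      moreover have "\<eta> * (grad_sq D x * V ^ Suc n) \<le> \<eta> * b x"
        unfolding b_def U_def[symmetric] using \<eta> p g0 by (intro mult_left_mono) (auto simp del: power_Suc)
      moreover have "\<omega> x * V ^ Suc n * grad_sq D x \<le> c x"
        using mult_right_mono[OF mult_left_mono[OF p(1)[of "Suc n"], of "\<omega> x"] g0[of x]] pos
        unfolding U1 by (simp add: c_def U_def mult_ac)
      moreover have "\<kappa> / d * ((\<omega> x)\<^sup>2 * V ^ Suc (Suc n) * grad_sq D x) \<le> \<kappa> / d * c x"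
        using mult_left_mono[OF mult_right_mono[OF mult_left_mono[OF p(1)[of "Suc (Suc n)"], of "(\<omega> x)\<^sup>2"] g0[of x]] \<kappa>]
        unfolding U2 by (simp add: c_def U_def mult_ac)
      moreover have "0 \<le> (lap D x)\<^sup>2 * V ^ n / \<eta>" "0 \<le> \<eta> * (grad_sq D x * V ^ Suc n)"
        "0 \<le> \<omega> x * V ^ Suc n * grad_sq D x"
        using \<eta> g0[of x] pos V(1) by auto
      moreover have "0 \<le> \<kappa> / d * ((\<omega> x)\<^sup>2 * V ^ Suc (Suc n) * grad_sq D x)"
        using g0[of x] V(1) by (intro mult_nonneg_nonneg[OF \<kappa>]) auto
      ultimately have "\<bar>h (inverse (real (Suc k))) x\<bar> \<le> a x / \<eta> + \<eta> * b x + (1 + \<kappa> / d) * c x"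
        unfolding h_def V_def[symmetric] distrib_right mult_1 by linarith
      then show ?thesis using True by (simp add: s_def w_def)
    qed
    with lim show ?thesis by blast
  qed
  have AE: "AE x in lborel. (\<lambda>k. s k x) \<longlonglongrightarrow> l x \<and> (\<forall>k. norm (s k x) \<le> w x)"
    using AE_\<omega>_pos by eventually_elim (rule ptw)
  have "(\<lambda>k. integral\<^sup>L lborel (s k)) \<longlonglongrightarrow> integral\<^sup>L lborel l"
    by (rule integral_dominated_convergence[OF meas_l meas_s int_w]) (use AE in auto)
  moreover have "0 \<le> integral\<^sup>L lborel (s k)" for k
    using regularized_step[OF D _ n, of "inverse (real (Suc k))"]
    unfolding s_def h_def \<kappa>_def \<eta>_def d_def by (simp add: set_lebesgue_integral_def)
  ultimately have "0 \<le> integral\<^sup>L lborel l"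
    by (intro LIMSEQ_le_const) auto
  also have "integral\<^sup>L lborel l = (LINT x:Q|lborel. a x / \<eta> - \<eta> * b x + (1 - \<kappa> / d) * c x)"
    by (simp add: set_lebesgue_integral_def l_def[abs_def])
  also have "\<dots> = (LINT x:Q|lborel. a x) / \<eta> - \<eta> * (LINT x:Q|lborel. b x) + (1 - \<kappa> / d) * (LINT x:Q|lborel. c x)"
    using int by (simp add: set_integral_add set_integral_diff)
  finally have "\<eta> * (LINT x:Q|lborel. b x) \<le> (LINT x:Q|lborel. a x) / \<eta> + (1 - \<kappa> / d) * (LINT x:Q|lborel. c x)"
    by simp
  then have "(LINT x:Q|lborel. b x) \<le> 1 / \<eta>\<^sup>2 * (LINT x:Q|lborel. a x) + (1 - \<kappa> / d) / \<eta> * (LINT x:Q|lborel. c x)"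
    using \<eta> by (simp add: field_simps power2_eq_square)
  moreover have "1 / \<eta>\<^sup>2 = C1 (- int n) CARD('n)"
    by (simp add: C1_def \<eta>_def d_def power_divide)
  moreover have "(1 - \<kappa> / d) / \<eta> = C2 (- int n) CARD('n)"
  proof -
    have "d - \<kappa> = (3 * d + 2 * real n + 4) * inverse 4" "\<eta> = (d + 2 * real n) * inverse 4"
      by (simp_all add: \<kappa>_def \<eta>_def field_simps)
    moreover have "(1 - \<kappa> / d) / \<eta> = (d - \<kappa>) / (d * \<eta>)"
      using dn by (simp add: diff_divide_distrib)
    ultimately have "(1 - \<kappa> / d) / \<eta>
        = ((3 * d + 2 * real n + 4) * inverse 4) / ((d * (d + 2 * real n)) * inverse 4)"
      by (simp only: mult.assoc)
    also have "\<dots> = (3 * d + 2 * real n + 4) / (d * (d + 2 * real n))"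
      by (rule mult_divide_mult_cancel_right) simp
    finally show ?thesis by (simp add: C2_def d_def)
  qed
  ultimately show ?thesis by (simp add: a_def b_def c_def)
qed

section \<open>The recursion for the constants and the induction\<close>

lemma C1_C2_nonneg:
  assumes "0 < d"
  shows "0 < C1 (- int n) d" "0 < C2 (- int n) d"
  using assms by (auto simp: C1_def C2_def add_pos_nonneg)

lemma inverse_HR_0: "inverse (HR 0 d) = C1 0 d + C2 0 d"
  by (simp add: HR_def)

text \<open>Split off the summand j = 0 and pull the factor i = 0 out of every remaining product.
  What is left is the expression for \<open>n\<close>, since raising the index by one turns
  \<open>- int (Suc n)\<close> into \<open>- int n\<close>.\<close>

lemma inverse_HR_Suc:
  "inverse (HR (- int (Suc n)) d)
    = C1 (- int (Suc n)) d + real d * C2 (- int (Suc n)) d * inverse (HR (- int n) d)"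
proof -
  have shift: "- int (Suc n) + int (Suc i) = - int n + int i" for i by simp
  have prod: "(\<Prod>i<Suc j. C2 (- int (Suc n) + int i) d)
      = C2 (- int (Suc n)) d * (\<Prod>i<j. C2 (- int n + int i) d)" for j
    unfolding prod.lessThan_Suc_shift shift by simp
  have "{0..m} = {..<Suc m}" for m :: nat by auto
  then show ?thesis
    unfolding HR_def inverse_inverse_eq
    by (simp only: minus_minus nat_int sum.lessThan_Suc_shift shift prod)
      (simp add: sum_distrib_left distrib_left mult_ac)
qed

lemma inverse_HR_pos:
  assumes "0 < d"
  shows "0 < inverse (HR (- int n) d)"
proof (induction n)
  case 0
  show ?case using C1_C2_nonneg[OF assms, of 0] by (simp add: inverse_HR_0)
next
  case (Suc n)
  then show ?case unfolding inverse_HR_Suc using C1_C2_nonneg[OF assms, of "Suc n"] assms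
    by (intro add_pos_pos mult_pos_pos) simp_all
qed

text \<open>\<open>weighted_step\<close> leaves a gradient integral with one power of 1 / \<omega>
  less, to which the induction hypothesis applies; \<omega> <= d then restores the power in the
  Laplacian integral at the cost of a factor d. The bookkeeping is
  \<open>inverse_HR_Suc\<close>.\<close>

lemma hardy_rellich_real:
  fixes D :: "'n list \<Rightarrow> real ^ 'n \<Rightarrow> real"
  assumes D: "derivative_family D" and n: "8 + 6 * n \<le> CARD('n)"
  shows "(LINT x:Q|lborel. grad_sq D x * inverse (\<omega> x) ^ Suc n)
    \<le> inverse (HR (- int n) CARD('n)) * (LINT x:Q|lborel. (lap D x)\<^sup>2 * inverse (\<omega> x) ^ n)"
  using n
proof (induction n)
  case 0
  have "C2 0 CARD('n) * (LINT x:Q|lborel. grad_sq D x) \<le> C2 0 CARD('n) * (LINT x:Q|lborel. (lap D x)\<^sup>2)"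
    using C1_C2_nonneg(2)[of "CARD('n)" 0] by (intro mult_left_mono integral_grad_sq_le D) auto
  then show ?case
    using weighted_step[OF D 0] by (simp add: inverse_HR_0 distrib_right)
next
  case (Suc n)
  let ?a = "\<lambda>m. LINT x:Q|lborel. (lap D x)\<^sup>2 * inverse (\<omega> x) ^ m"
  have C2: "0 < C2 (- int (Suc n)) CARD('n)" by (rule C1_C2_nonneg) simp
  have "?a n \<le> (LINT x:Q|lborel. real CARD('n) * ((lap D x)\<^sup>2 * inverse (\<omega> x) ^ Suc n))"
  proof (rule set_integral_mono_AE)
    have cont: "continuous_on cube (\<lambda>x. (lap D x)\<^sup>2)"
      by (intro continuous_intros continuous_on_lap_grad_sq[OF D])
    show "set_integrable lborel Q (\<lambda>x. (lap D x)\<^sup>2 * inverse (\<omega> x) ^ n)"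
      using Suc.prems by (intro integrable_mult_\<omega>_power cont) simp
    show "set_integrable lborel Q (\<lambda>x. real CARD('n) * ((lap D x)\<^sup>2 * inverse (\<omega> x) ^ Suc n))"
      using Suc.prems by (intro set_integrable_mult_right integrable_mult_\<omega>_power cont) simp
    show "AE x\<in>Q in lborel. (lap D x)\<^sup>2 * inverse (\<omega> x) ^ n
      \<le> real CARD('n) * ((lap D x)\<^sup>2 * inverse (\<omega> x) ^ Suc n)"
      using AE_\<omega>_pos
    proof (eventually_elim, intro impI)
      fix x :: "real ^ 'n" assume "x \<in> Q \<longrightarrow> 0 < \<omega> x" "x \<in> Q"
      then have "1 \<le> real CARD('n) * inverse (\<omega> x)"
        using \<omega>_le[of x] by (simp add: field_simps)
      from mult_left_mono[OF this, of "(lap D x)\<^sup>2 * inverse (\<omega> x) ^ n"]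
      show "(lap D x)\<^sup>2 * inverse (\<omega> x) ^ n \<le> real CARD('n) * ((lap D x)\<^sup>2 * inverse (\<omega> x) ^ Suc n)"
        using \<omega>_nonneg[of x] by (simp add: mult_ac)
    qed
  qed
  then have an: "?a n \<le> real CARD('n) * ?a (Suc n)" by simp
  have "(LINT x:Q|lborel. grad_sq D x * inverse (\<omega> x) ^ Suc n) \<le> inverse (HR (- int n) CARD('n)) * ?a n"
    using Suc by simp
  also have "\<dots> \<le> inverse (HR (- int n) CARD('n)) * (real CARD('n) * ?a (Suc n))"
    using inverse_HR_pos[of "CARD('n)" n] by (intro mult_left_mono an) auto
  finally have "C2 (- int (Suc n)) CARD('n) * (LINT x:Q|lborel. grad_sq D x * inverse (\<omega> x) ^ Suc n)
      \<le> C2 (- int (Suc n)) CARD('n) * (inverse (HR (- int n) CARD('n)) * (real CARD('n) * ?a (Suc n)))"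
    using C2 by (intro mult_left_mono) auto
  moreover have "(p + d * q * r) * y = p * y + q * (r * (d * y))" for p q r d y :: real
    by (simp add: algebra_simps)
  ultimately show ?case
    using weighted_step[OF D Suc.prems] unfolding inverse_HR_Suc by simp
qed

section \<open>Passage from \<psi> to real derivative families\<close>

lemma iter_partial_Cons:
  "iter_partial S (i # is) f = partial_within S i (iter_partial S is f)"
  by (simp add: iter_partial_def)

text \<open>\<open>\<phi>\<close> stands for the real or imaginary part. The definition of
  smoothness differentiates at parameter 0 through the moving point \<open>y\<close>; a translation
  of the parameter turns this into the derivative at \<open>t\<close> along the fixed line through
  \<open>x\<close>.\<close>

lemma derivative_family_iter_partial:
  fixes \<psi> :: "real ^ 'n \<Rightarrow> complex" and \<phi> :: "complex \<Rightarrow> real"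
  assumes \<phi>: "bounded_linear \<phi>"
    and smooth: "C_infinity_on (closure Q) \<psi>"
    and per: "\<And>is. periodic_each_var (iter_partial (closure Q) is \<psi>)"
  shows "derivative_family (\<lambda>is x. \<phi> (iter_partial (closure Q) is \<psi> x))"
  unfolding derivative_family_def
proof (intro allI)
  fix "is" :: "'n list" and i
  define f where "f = iter_partial (closure Q) is \<psi>"
  define f' where "f' = partial_within (closure Q) i f"
  have f: "continuous_on cube f" "continuous_on cube f'"
    and diff: "\<And>x. x \<in> cube \<Longrightarrow> partial_differentiable_within cube i f x"
    using smooth by (auto simp: C_infinity_on_def f_def f'_def cube_def iter_partial_Cons[symmetric])
  have "periodic_partial i (\<lambda>x. \<phi> (f x)) (\<lambda>x. \<phi> (f' x))"
    unfolding periodic_partial_def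
  proof (intro conjI ballI impI)
    show "continuous_on cube (\<lambda>x. \<phi> (f x))" "continuous_on cube (\<lambda>x. \<phi> (f' x))"
      by (intro bounded_linear.continuous_on[OF \<phi>] f)+
    fix x :: "real ^ 'n" assume x: "x \<in> cube" "x $ i = 0"
    have along_eq: "along x i s = (\<chi> j. if j = i then s else x $ j)" for s
      using x(2) by (auto simp: vec_eq_iff axis_def)
    show "\<phi> (f (along x i pi)) = \<phi> (f (along x i (- pi)))"
      unfolding along_eq using per[of "is"] x(1) by (simp add: periodic_each_var_def f_def cube_def)
    fix t assume t: "t \<in> {- pi..pi}"
    define y where "y = along x i t"
    have y: "y \<in> cube" unfolding y_def by (rule along_mem_cube[OF x t])
    have "((\<lambda>s. f (along y i s)) has_vector_derivative f' y) (at 0 within {s. along y i s \<in> cube})"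
      using diff[OF y] unfolding partial_differentiable_within_def f'_def partial_within_def cube_def[symmetric]
      by (simp add: vector_derivative_works)
    \<comment> \<open>The trivial-looking \<open>t - t\<close> and the shifted interval put the
      derivative into the form needed for the chain rule with the inner map s - t.\<close>
    then have "((\<lambda>s. f (along y i s)) has_vector_derivative f' y) (at (t - t) within (\<lambda>s. s - t) ` {- pi..pi})"
      unfolding diff_self
      by (rule has_vector_derivative_within_subset) (auto simp: y_def along_add intro!: along_mem_cube[OF x])
    then have "((\<lambda>s. f (along y i s)) \<circ> (\<lambda>s. s - t) has_vector_derivative 1 *\<^sub>R f' y) (at t within {- pi..pi})"
      by (intro vector_diff_chain_within) (auto intro!: derivative_eq_intros)
    moreover have "(\<lambda>s. f (along y i s)) \<circ> (\<lambda>s. s - t) = (\<lambda>s. f (along x i s))"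
      by (simp add: fun_eq_iff y_def along_add)
    ultimately have "((\<lambda>s. f (along x i s)) has_vector_derivative f' y) (at t within {- pi..pi})"
      by simp
    from bounded_linear.has_vector_derivative[OF \<phi> this]
    show "((\<lambda>s. \<phi> (f (along x i s))) has_real_derivative \<phi> (f' (along x i t))) (at t within {- pi..pi})"
      by (simp add: has_real_derivative_iff_has_vector_derivative y_def)
  qed
  then show "periodic_partial i (\<lambda>x. \<phi> (iter_partial (closure Q) is \<psi> x))
      (\<lambda>x. \<phi> (iter_partial (closure Q) (i # is) \<psi> x))"
    by (simp add: f_def f'_def iter_partial_Cons)
qed

theorem theorem3p5:
  fixes k :: int and \<psi> :: "real ^ 'n \<Rightarrow> complex"
  assumes "k \<le> 0"
    and "int CARD('n) \<ge> - 6 * k + 8"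
    and "C_infinity_on (closure Q) \<psi>"
    and "\<And>is. periodic_each_var (iter_partial (closure Q) is \<psi>)"
    and "(LINT x:Q|lborel. \<psi> x) = 0"
  shows "HR k CARD('n) * (LINT x:Q|lborel. (norm (grad \<psi> x))\<^sup>2 * \<omega> x powi (k - 1))
         \<le> (LINT x:Q|lborel. (norm (laplacian \<psi> x))\<^sup>2 * \<omega> x powi k)"
proof -
  define n where "n = nat (- k)"
  have k: "k = - int n" using assms(1) by (simp add: n_def)
  have n: "8 + 6 * n \<le> CARD('n)" using assms(2) unfolding k by linarith
  \<comment> \<open>The squared norms of gradient and Laplacian split into contributions of the real
    and imaginary parts, so the real inequality is applied to each and the results are
    added.\<close>
  define u where "u is x = Re (iter_partial (closure Q) is \<psi> x)" for "is" x
  define v where "v is x = Im (iter_partial (closure Q) is \<psi> x)" for "is" x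
  have u: "derivative_family u" and v: "derivative_family v"
    unfolding u_def v_def
    by (intro derivative_family_iter_partial bounded_linear_Re bounded_linear_Im assms)+
  have grad: "(norm (grad \<psi> x))\<^sup>2 = grad_sq u x + grad_sq v x" for x
    by (simp add: norm_vec_def L2_set_def sum_nonneg grad_def grad_sq_def u_def v_def
        iter_partial_def cmod_power2 sum.distrib)
  have lap: "(norm (laplacian \<psi> x))\<^sup>2 = (lap u x)\<^sup>2 + (lap v x)\<^sup>2" for x
    by (simp add: laplacian_def lap_def u_def v_def iter_partial_def cmod_power2)
  have powi: "\<omega> x powi (k - 1) = inverse (\<omega> x) ^ Suc n" "\<omega> x powi k = inverse (\<omega> x) ^ n" for x :: "real ^ 'n"
  proof -
    have "k - 1 = - int (Suc n)" by (simp add: k)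
    then show "\<omega> x powi (k - 1) = inverse (\<omega> x) ^ Suc n"
      by (simp only: power_int_minus power_int_of_nat power_inverse)
    show "\<omega> x powi k = inverse (\<omega> x) ^ n"
      by (simp only: k power_int_minus power_int_of_nat power_inverse)
  qed
  have int_u: "set_integrable lborel Q (\<lambda>x. grad_sq u x * inverse (\<omega> x) ^ Suc n)"
      "set_integrable lborel Q (\<lambda>x. (lap u x)\<^sup>2 * inverse (\<omega> x) ^ n)"
    and int_v: "set_integrable lborel Q (\<lambda>x. grad_sq v x * inverse (\<omega> x) ^ Suc n)"
      "set_integrable lborel Q (\<lambda>x. (lap v x)\<^sup>2 * inverse (\<omega> x) ^ n)"
    by (intro integrable_mult_\<omega>_power continuous_intros continuous_on_lap_grad_sq u v; use n in simp)+
  have "(LINT x:Q|lborel. (norm (grad \<psi> x))\<^sup>2 * \<omega> x powi (k - 1))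
      = (LINT x:Q|lborel. grad_sq u x * inverse (\<omega> x) ^ Suc n) + (LINT x:Q|lborel. grad_sq v x * inverse (\<omega> x) ^ Suc n)"
    unfolding grad powi distrib_right using int_u int_v by (intro set_integral_add)
  also have "\<dots> \<le> inverse (HR k CARD('n)) * ((LINT x:Q|lborel. (lap u x)\<^sup>2 * inverse (\<omega> x) ^ n)
      + (LINT x:Q|lborel. (lap v x)\<^sup>2 * inverse (\<omega> x) ^ n))"
    unfolding distrib_left k by (intro add_mono hardy_rellich_real u v n)
  also have "(LINT x:Q|lborel. (lap u x)\<^sup>2 * inverse (\<omega> x) ^ n) + (LINT x:Q|lborel. (lap v x)\<^sup>2 * inverse (\<omega> x) ^ n)
      = (LINT x:Q|lborel. (norm (laplacian \<psi> x))\<^sup>2 * \<omega> x powi k)"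
    unfolding lap powi distrib_right using int_u int_v by (intro set_integral_add(2)[symmetric])
  finally have "(LINT x:Q|lborel. (norm (grad \<psi> x))\<^sup>2 * \<omega> x powi (k - 1))
      \<le> inverse (HR k CARD('n)) * (LINT x:Q|lborel. (norm (laplacian \<psi> x))\<^sup>2 * \<omega> x powi k)" .
  moreover have "0 < HR k CARD('n)"
    using inverse_HR_pos[of "CARD('n)" n] by (simp add: k)
  ultimately show ?thesis by (simp add: field_simps)
qed

end
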